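(* Assume Condition 2. If $P_{\mathrm{MH}}$ is geometrically ergodic, then $P_3$ is geometrically ergodic.
   Context: Let $\Theta$ be a metric space with a dominating measure $\mathrm d\theta$ for densities on $\Theta$. Fix data $y$ in a metric space $\mathsf Y$, a tolerance $\epsilon>0$, a prior density $p:\Theta\to\mathbb R_+$ (possibly improper), and for each $\theta$ a probability density $f_\theta$ on $\mathsf Y$. Let $B_{r,z}$ be the ball of radius $r$ about $z$, $h(\theta)=f_\theta(B_{\epsilon,y})\in[0,1]$, assume $H=\int p h\,\mathrm d\theta\in(0,\infty)$ and let $\pi(\theta)=p(\theta)h(\theta)/H$. Let $q(\theta,\cdot)$ be a proposal density and $c(\theta,\vartheta)=p(\theta)q(\theta,\vartheta)$. For an acceptance function $\alpha$ the associated kernel is $P(\theta,\mathrm d\vartheta)=q(\theta,\mathrm d\vartheta)\alpha(\theta,\vartheta)+\{1-\int_\Theta q(\theta,\mathrm d\theta')\alpha(\theta,\theta')\}\delta_\theta(\mathrm d\vartheta)$. $P_{\mathrm{MH}}$ uses $\alpha_{\mathrm{MH}}(\theta,\vartheta)=1\wedge\frac{c(\vartheta,\theta)h(\vartheta)}{c(\theta,\vartheta)h(\theta)}$ and $P_3$ uses $\alpha_3(\theta,\vartheta)=\{1\wedge\frac{c(\vartheta,\theta)}{c(\theta,\vartheta)}\}\frac{h(\vartheta)}{h(\theta)+h(\vartheta)-h(\theta)h(\vartheta)}$; both are reversible w.r.t. $\pi$. A reversible kernel $P$ is geometrically ergodic iff $\sup|\sigma_0(P)|<1$, where $\sigma_0(P)$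 is its spectrum on $L^2_0(\pi)$ (equivalently $\|P^m(\theta_0,\cdot)-\pi\|_{TV}\le C(\theta_0)\rho^m$ for some $\rho<1$). $\mathcal Q$ is the set of proposals $q$ such that for all $\delta>0$ there is $r\in(0,\infty)$ with $q(\theta,B^\complement_{r,\theta})<\delta$ for all $\theta$. Condition 2: $q\in\mathcal Q$, and for every $K>0$ there exists $M_K\in[1,\infty)$ such that for all $(\theta,\vartheta)$ with $\vartheta\in B_{K,\theta}$ and $\pi(\theta)q(\theta,\vartheta)\wedge\pi(\vartheta)q(\vartheta,\theta)>0$, either $h(\vartheta)/h(\theta)\in[M_K^{-1},M_K]$ or $c(\vartheta,\theta)/c(\theta,\vartheta)\in[M_K^{-1},M_K]$. *)

theory Defs
  imports "HOL-Probability.Probability"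
begin

text \<open>Setting: \<Theta> is the type 'a (a metric space) carrying the dominating measure mu
(on its Borel sets); Y is the type 'b (a metric space) carrying a reference measure nu
for the densities f_theta.\<close>

definition hfun :: "'b::metric_space measure \<Rightarrow> ('a \<Rightarrow> 'b \<Rightarrow> real) \<Rightarrow> 'b \<Rightarrow> real \<Rightarrow> 'a \<Rightarrow> real" where
  "hfun nu f y eps \<theta> = (LINT z:ball y eps|nu. f \<theta> z)"

definition qmass :: "'a measure \<Rightarrow> ('a \<Rightarrow> 'a \<Rightarrow> real) \<Rightarrow> 'a \<Rightarrow> 'a set \<Rightarrow> ennreal" where
  "qmass mu q \<theta> A = (\<integral>\<^sup>+\<eta>\<in>A. ennreal (q \<theta> \<eta>) \<partial>mu)"

definition in_Q :: "'a::metric_space measure \<Rightarrow> ('a \<Rightarrow> 'a \<Rightarrow> real) \<Rightarrow> bool" where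
  "in_Q mu q \<longleftrightarrow> (\<forall>\<delta>>0. \<exists>r>0. \<forall>\<theta>. qmass mu q \<theta> (- ball \<theta> r) < ennreal \<delta>)"

definition cfun :: "('a \<Rightarrow> real) \<Rightarrow> ('a \<Rightarrow> 'a \<Rightarrow> real) \<Rightarrow> 'a \<Rightarrow> 'a \<Rightarrow> real" where
  "cfun p q \<theta> \<eta> = p \<theta> * q \<theta> \<eta>"

text \<open>Condition 2; pd is the (normalised) density of pi.\<close>
definition condition2 :: "'a::metric_space measure \<Rightarrow> ('a \<Rightarrow> real) \<Rightarrow> ('a \<Rightarrow> 'a \<Rightarrow> real)
    \<Rightarrow> ('a \<Rightarrow> real) \<Rightarrow> ('a \<Rightarrow> real) \<Rightarrow> bool" where
  "condition2 mu p q h pd \<longleftrightarrow> in_Q mu q \<and>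
     (\<forall>K>0. \<exists>M\<ge>1. \<forall>\<theta> \<eta>. \<eta> \<in> ball \<theta> K \<and> min (pd \<theta> * q \<theta> \<eta>) (pd \<eta> * q \<eta> \<theta>) > 0 \<longrightarrow>
        (h \<eta> / h \<theta> \<in> {1/M..M} \<or> cfun p q \<eta> \<theta> / cfun p q \<theta> \<eta> \<in> {1/M..M}))"

text \<open>Acceptance functions (HOL convention x/0 = 0; only relevant off the support of pi).\<close>
definition alpha_MH :: "('a \<Rightarrow> real) \<Rightarrow> ('a \<Rightarrow> 'a \<Rightarrow> real) \<Rightarrow> ('a \<Rightarrow> real) \<Rightarrow> 'a \<Rightarrow> 'a \<Rightarrow> real" where
  "alpha_MH p q h \<theta> \<eta> = min 1 ((cfun p q \<eta> \<theta> * h \<eta>) / (cfun p q \<theta> \<eta> * h \<theta>))"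

definition alpha_3 :: "('a \<Rightarrow> real) \<Rightarrow> ('a \<Rightarrow> 'a \<Rightarrow> real) \<Rightarrow> ('a \<Rightarrow> real) \<Rightarrow> 'a \<Rightarrow> 'a \<Rightarrow> real" where
  "alpha_3 p q h \<theta> \<eta> = min 1 (cfun p q \<eta> \<theta> / cfun p q \<theta> \<eta>) *
      (h \<eta> / (h \<theta> + h \<eta> - h \<theta> * h \<eta>))"

definition mh_kernel :: "'a measure \<Rightarrow> ('a \<Rightarrow> 'a \<Rightarrow> real) \<Rightarrow> ('a \<Rightarrow> 'a \<Rightarrow> real) \<Rightarrow> 'a \<Rightarrow> 'a measure" where
  "mh_kernel mu q \<alpha> \<theta> = measure_of (space mu) (sets mu)
     (\<lambda>A. (\<integral>\<^sup>+\<eta>\<in>A. ennreal (q \<theta> \<eta> * \<alpha> \<theta> \<eta>) \<partial>mu)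
          + (1 - (\<integral>\<^sup>+\<eta>. ennreal (q \<theta> \<eta> * \<alpha> \<theta> \<eta>) \<partial>mu)) * indicator A \<theta>)"

fun kernel_pow :: "'a measure \<Rightarrow> ('a \<Rightarrow> 'a measure) \<Rightarrow> nat \<Rightarrow> 'a \<Rightarrow> 'a measure" where
  "kernel_pow mu P 0 \<theta> = return mu \<theta>"
| "kernel_pow mu P (Suc m) \<theta> = bind (kernel_pow mu P m \<theta>) P"

definition tv_dist :: "'a measure \<Rightarrow> 'a measure \<Rightarrow> real" where
  "tv_dist M N = (SUP A \<in> sets M. \<bar>measure M A - measure N A\<bar>)"

definition geom_ergodic :: "'a measure \<Rightarrow> 'a measure \<Rightarrow> ('a \<Rightarrow> 'a measure) \<Rightarrow> bool" where
  "geom_ergodic mu \<pi> P \<longleftrightarrow> (\<exists>\<rho>::real. 0 \<le> \<rho> \<and> \<rho> < 1 \<and> (\<exists>C::'a \<Rightarrow> real.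
      AE \<theta>0 in \<pi>. \<forall>m. tv_dist (kernel_pow mu P m \<theta>0) \<pi> \<le> C \<theta>0 * \<rho> ^ m))"

end

theory Submission
  imports Defs
begin

text \<open>
  Everything is done on bounded measurable functions with the inner product of \<open>L\<^sup>2(\<pi>)\<close>.

  If \<open>P\<^sub>M\<^sub>H\<close> converges geometrically in total variation, then \<open>\<langle>f, P\<^sup>m f\<rangle>\<close> decays like \<open>\<rho>\<^sup>m\<close> for
  centred \<open>f\<close> from a dense class. Since \<open>m \<mapsto> \<parallel>P\<^sup>m f\<parallel>\<^sup>2\<close> is log-convex, this forces
  \<open>\<parallel>P f\<parallel> \<le> \<rho> \<parallel>f\<parallel>\<close>, a two-sided spectral gap.

  The flow of \<open>P\<^sub>3\<close> is dominated by that of \<open>P\<^sub>M\<^sub>H\<close>, so its Dirichlet form is smaller and the gap at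
  \<open>-1\<close> is inherited. By Condition 2 the flow of \<open>P\<^sub>3\<close> is at least \<open>1/(2M)\<close> times that of
  \<open>P\<^sub>M\<^sub>H\<close> inside balls of radius \<open>r\<close>, and moves leaving these balls contribute at most
  \<open>2 \<delta> \<parallel>f\<parallel>\<^sup>2\<close> to the Dirichlet form, so the gap at \<open>1\<close> survives too.

  To return to total variation, truncate the transition density of \<open>P = P\<^sub>3\<close> with respect to \<open>\<pi>\<close> at
  \<open>1\<close>: \<open>P = R + K\<close> with positive symmetric \<open>R\<close> and \<open>K\<close>. Unless the chain never moves, the spectral
  gap and \<open>\<langle>1, K 1\<rangle> > 0\<close> give \<open>\<parallel>R\<parallel> < 1\<close>, hence \<open>R\<^sup>m 1\<close> decays geometrically almost everywhere.
  In \<open>P\<^sup>m = R\<^sup>m + (\<Sum>j<m. R\<^sup>j K P\<^sup>m\<^sup>-\<^sup>1\<^sup>-\<^sup>j)\<close> the kernel \<open>K\<close> maps \<open>L\<^sup>1\<close> to bounded functions, so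
  all terms decay uniformly over bounded test functions.
\<close>

section \<open>Symmetric operators on bounded functions\<close>

text \<open>Boundedness is required everywhere, not almost everywhere, and no quotient is taken:
  kernels act on such functions pointwise, and every integral over a finite measure exists.\<close>

definition bdd_fun :: "'a measure \<Rightarrow> ('a \<Rightarrow> real) set" where
  "bdd_fun M = {f \<in> borel_measurable M. \<exists>B. \<forall>x. \<bar>f x\<bar> \<le> B}"

definition ip :: "'a measure \<Rightarrow> ('a \<Rightarrow> real) \<Rightarrow> ('a \<Rightarrow> real) \<Rightarrow> real" where
  "ip M f g = (LINT x|M. f x * g x)"

text \<open>Linearity is an equality of functions at every point, so that iterates can be evaluated
  at a fixed starting point. Symmetry refers to \<open>ip\<close>, hence to
  \<open>M\<close>.\<close>

definition sym_op :: "'a measure \<Rightarrow> (('a \<Rightarrow> real) \<Rightarrow> 'a \<Rightarrow> real) \<Rightarrow> bool" where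
  "sym_op M T \<longleftrightarrow>
     (\<forall>f\<in>bdd_fun M. T f \<in> bdd_fun M) \<and>
     (\<forall>f\<in>bdd_fun M. \<forall>g\<in>bdd_fun M. T (\<lambda>x. f x + g x) = (\<lambda>x. T f x + T g x)) \<and>
     (\<forall>f\<in>bdd_fun M. \<forall>c. T (\<lambda>x. c * f x) = (\<lambda>x. c * T f x)) \<and>
     (\<forall>f\<in>bdd_fun M. \<forall>g\<in>bdd_fun M. ip M f (T g) = ip M (T f) g)"

lemma bdd_funI: "f \<in> borel_measurable M \<Longrightarrow> (\<And>x. \<bar>f x\<bar> \<le> B) \<Longrightarrow> f \<in> bdd_fun M"
  by (auto simp: bdd_fun_def)

lemma bdd_fun_measurable [measurable_dest]: "f \<in> bdd_fun M \<Longrightarrow> f \<in> borel_measurable M"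
  by (simp add: bdd_fun_def)

lemma bdd_funE:
  assumes "f \<in> bdd_fun M"
  obtains B where "0 \<le> B" "\<And>x. \<bar>f x\<bar> \<le> B"
  using assms unfolding bdd_fun_def by (auto intro: order_trans[OF abs_ge_zero])

lemma bdd_fun_const [simp, intro]: "(\<lambda>x. c) \<in> bdd_fun M"
  by (rule bdd_funI[of _ _ "\<bar>c\<bar>"]) auto

lemma bdd_fun_indicator [simp, intro]: "A \<in> sets M \<Longrightarrow> indicator A \<in> bdd_fun M"
  by (rule bdd_funI[of _ _ 1]) (auto simp: indicator_def)

lemma bdd_fun_add [simp, intro]:
  assumes "f \<in> bdd_fun M" "g \<in> bdd_fun M"
  shows "(\<lambda>x. f x + g x) \<in> bdd_fun M"
proof -
  obtain B where B: "\<And>x. \<bar>f x\<bar> \<le> B" by (rule bdd_funE[OF assms(1)]) auto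
  obtain C where C: "\<And>x. \<bar>g x\<bar> \<le> C" by (rule bdd_funE[OF assms(2)]) auto
  have [measurable]: "f \<in> borel_measurable M" "g \<in> borel_measurable M"
    using assms by (simp_all add: bdd_fun_def)
  show ?thesis
    by (rule bdd_funI[of _ _ "B + C"]) (measurable, meson B C abs_triangle_ineq add_mono order_trans)
qed

lemma bdd_fun_mult [simp, intro]:
  assumes "f \<in> bdd_fun M" "g \<in> bdd_fun M"
  shows "(\<lambda>x. f x * g x) \<in> bdd_fun M"
proof -
  obtain B where B: "0 \<le> B" "\<And>x. \<bar>f x\<bar> \<le> B" by (rule bdd_funE[OF assms(1)]) auto
  obtain C where C: "\<And>x. \<bar>g x\<bar> \<le> C" by (rule bdd_funE[OF assms(2)]) auto
  have [measurable]: "f \<in> borel_measurable M" "g \<in> borel_measurable M"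
    using assms by (simp_all add: bdd_fun_def)
  show ?thesis
    by (rule bdd_funI[of _ _ "B * C"]) (measurable, simp add: B C abs_mult mult_mono)
qed

lemma bdd_fun_diff [simp, intro]:
  assumes "f \<in> bdd_fun M" "g \<in> bdd_fun M"
  shows "(\<lambda>x. f x - g x) \<in> bdd_fun M"
  using bdd_fun_add[OF assms(1) bdd_fun_mult[OF bdd_fun_const[of "-1"] assms(2)]] by simp

lemma bdd_fun_abs [simp, intro]: "f \<in> bdd_fun M \<Longrightarrow> (\<lambda>x. \<bar>f x\<bar>) \<in> bdd_fun M"
  by (auto simp: bdd_fun_def)

lemma sym_opD:
  assumes "sym_op M T" "f \<in> bdd_fun M"
  shows "T f \<in> bdd_fun M"
    and "T (\<lambda>x. c * f x) = (\<lambda>x. c * T f x)"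
    and "g \<in> bdd_fun M \<Longrightarrow> T (\<lambda>x. f x + g x) = (\<lambda>x. T f x + T g x)"
    and "g \<in> bdd_fun M \<Longrightarrow> ip M f (T g) = ip M (T f) g"
  using assms by (simp_all add: sym_op_def)

lemma ip_commute: "ip M f g = ip M g f"
  by (simp add: ip_def mult.commute)

lemma ip_nonneg [simp]: "0 \<le> ip M f f"
  by (simp add: ip_def)

lemma ip_scale [simp]: "ip M (\<lambda>x. c * f x) g = c * ip M f g"
    "ip M f (\<lambda>x. c * g x) = c * ip M f g"
  by (simp_all add: ip_def mult.assoc mult.left_commute)

section \<open>Inner product and norm on bounded functions\<close>

context finite_measure
begin

lemma bdd_fun_integrable [simp, intro]: "f \<in> bdd_fun M \<Longrightarrow> integrable M f"
  by (rule bdd_funE, assumption, rule integrable_const_bound) (auto simp: bdd_fun_measurable)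

lemma ip_add:
  assumes "f \<in> bdd_fun M" "g \<in> bdd_fun M" "h \<in> bdd_fun M"
  shows "ip M (\<lambda>x. f x + g x) h = ip M f h + ip M g h"
    and "ip M h (\<lambda>x. f x + g x) = ip M h f + ip M h g"
  using assms by (simp_all add: ip_def distrib_left distrib_right)

lemma ip_diff:
  assumes "f \<in> bdd_fun M" "g \<in> bdd_fun M" "h \<in> bdd_fun M"
  shows "ip M (\<lambda>x. f x - g x) h = ip M f h - ip M g h"
    and "ip M h (\<lambda>x. f x - g x) = ip M h f - ip M h g"
  using assms by (simp_all add: ip_def right_diff_distrib left_diff_distrib)

lemma ip_Cauchy_Schwarz:
  assumes f: "f \<in> bdd_fun M" and g: "g \<in> bdd_fun M"
  shows "(ip M f g)\<^sup>2 \<le> ip M f f * ip M g g"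
proof -
  define F where "F = ip M f f"
  define G where "G = ip M g g"
  define X where "X = ip M f g"
  have nn: "F \<ge> 0" "G \<ge> 0" by (simp_all add: F_def G_def)
  have key: "0 \<le> a\<^sup>2 * F - 2 * a * b * X + b\<^sup>2 * G" for a b
  proof -
    have "0 \<le> ip M (\<lambda>x. a * f x - b * g x) (\<lambda>x. a * f x - b * g x)"
      by simp
    also have "\<dots> = a\<^sup>2 * F - 2 * a * b * X + b\<^sup>2 * G"
      using f g ip_commute[of M g f]
      by (simp add: ip_diff F_def G_def X_def algebra_simps power2_eq_square)
    finally show ?thesis .
  qed
  show ?thesis
  proof (cases "G = 0")
    case True
    have "X = 0"
    proof (rule ccontr)
      assume "X \<noteq> 0"
      \<comment> \<open>With \<open>G = 0\<close> the form is affine in \<open>b\<close>; this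
        choice of \<open>b\<close> makes its value \<open>-1\<close>.\<close>
      have "0 \<le> F - 2 * ((F + 1) / (2 * X)) * X"
        using key[of 1 "(F + 1) / (2 * X)"] True by simp
      then show False using \<open>X \<noteq> 0\<close> by simp
    qed
    then show ?thesis using nn by (simp add: F_def G_def X_def)
  next
    case False
    \<comment> \<open>For \<open>a = G\<close> the choice \<open>b = X\<close> minimises the
      form.\<close>
    have "0 \<le> G\<^sup>2 * F - 2 * G * X * X + X\<^sup>2 * G" by (rule key)
    also have "\<dots> = G * (F * G - X\<^sup>2)" by (simp add: power2_eq_square algebra_simps)
    finally have "X\<^sup>2 \<le> F * G" using False nn by (simp add: zero_le_mult_iff)
    then show ?thesis by (simp add: F_def G_def X_def)
  qed
qed

definition nrm :: "('a \<Rightarrow> real) \<Rightarrow> real" where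
  "nrm f = sqrt (ip M f f)"

lemma nrm_nonneg [simp]: "0 \<le> nrm f"
  by (simp add: nrm_def)

lemma nrm_power2: "(nrm f)\<^sup>2 = ip M f f"
  by (simp add: nrm_def)

lemma abs_ip_le: "f \<in> bdd_fun M \<Longrightarrow> g \<in> bdd_fun M \<Longrightarrow> \<bar>ip M f g\<bar> \<le> nrm f * nrm g"
  using real_sqrt_le_mono[OF ip_Cauchy_Schwarz[of f g]] by (simp add: nrm_def real_sqrt_mult)

lemma nrm_triangle:
  assumes f: "f \<in> bdd_fun M" and g: "g \<in> bdd_fun M"
  shows "nrm (\<lambda>x. f x + g x) \<le> nrm f + nrm g"
proof (rule power2_le_imp_le)
  have "ip M f g \<le> nrm f * nrm g" using abs_ip_le[OF f g] by simp
  then show "(nrm (\<lambda>x. f x + g x))\<^sup>2 \<le> (nrm f + nrm g)\<^sup>2"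
    using f g ip_commute[of M g f] by (simp add: nrm_power2 ip_add power2_sum)
qed simp

section \<open>Norm bounds from decay and from the numerical radius\<close>

text \<open>Symmetry gives
  \<open>ip M ((T ^^ i) f) ((T ^^ j) f) = ip M f ((T ^^ (i + j)) f)\<close>, so the squared norms
  \<open>a m\<close> are log-convex and their asymptotic rate controls their very first quotient.
  The constant \<open>C\<close> disappears in the limit.\<close>

lemma sym_op_decay_imp_contraction:
  assumes T: "sym_op M T" and f: "f \<in> bdd_fun M" and \<rho>: "0 < \<rho>"
    and decay: "\<And>m. \<bar>ip M f ((T ^^ m) f)\<bar> \<le> C * \<rho> ^ m"
  shows "nrm (T f) \<le> \<rho> * nrm f"
proof -
  have b: "(T ^^ m) f \<in> bdd_fun M" for m
    using T f by (induction m) (auto simp: sym_op_def)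
  have move: "ip M ((T ^^ i) f) ((T ^^ j) f) = ip M f ((T ^^ (i + j)) f)" for i j
  proof (induction i arbitrary: j)
    case (Suc i)
    have "ip M ((T ^^ Suc i) f) ((T ^^ j) f) = ip M ((T ^^ i) f) ((T ^^ Suc j) f)"
      using T b[of i] b[of j] by (simp add: sym_op_def)
    then show ?case using Suc.IH[of "Suc j"] by simp
  qed simp
  define a where "a m = ip M ((T ^^ m) f) ((T ^^ m) f)" for m
  have nn: "a m \<ge> 0" for m by (simp add: a_def)
  have bound: "a m \<le> C * (\<rho>\<^sup>2) ^ m" for m
    using decay[of "m + m"] by (simp add: a_def move power_mult[symmetric] mult_2[symmetric])
  have convex: "(a (Suc m))\<^sup>2 \<le> a m * a (Suc (Suc m))" for m
    using ip_Cauchy_Schwarz[OF b[of m] b[of "Suc (Suc m)"]] move[of m "Suc (Suc m)"]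
      move[of "Suc m" "Suc m"]
    by (simp add: a_def)
  have "a 1 \<le> \<rho>\<^sup>2 * a 0"
  proof (cases "a 1 = 0")
    case True
    then show ?thesis using nn by simp
  next
    case False
    then have a1: "a 1 > 0" using nn[of 1] by simp
    have "a 0 \<noteq> 0" using convex[of 0] a1 by auto
    then have a0: "a 0 > 0" using nn[of 0] by simp
    define t where "t = a 1 / a 0"
    have t: "t > 0" using a0 a1 by (simp add: t_def)
    \<comment> \<open>By log-convexity the quotients \<open>a (Suc m) / a m\<close> never decrease,
      so the first one, \<open>t\<close>, bounds all of them from below. Positivity is carried along
      because \<open>a m\<close> has to be cancelled.\<close>
    have ratio: "a m > 0 \<and> t * a m \<le> a (Suc m)" for m
    proof (induction m)
      case 0
      then show ?case using a0 by (simp add: t_def)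
    next
      case (Suc m)
      then have p: "a m > 0" "a (Suc m) > 0"
        using t by (auto intro: less_le_trans[OF mult_pos_pos])
      have "t * a (Suc m) * a m \<le> a (Suc m) * a (Suc m)"
        using Suc p by (simp add: mult.assoc mult.left_commute mult_left_mono)
      also have "\<dots> \<le> a (Suc (Suc m)) * a m"
        using convex[of m] by (simp add: power2_eq_square mult.commute)
      finally show ?case using p by simp
    qed
    have growth: "a 0 * t ^ m \<le> a m" for m
    proof (induction m)
      case (Suc m)
      have "a 0 * t ^ Suc m \<le> t * a m"
        using Suc t mult_left_mono[of "a 0 * t ^ m" "a m" t] by (simp add: mult_ac)
      with ratio[of m] show ?case by linarith
    qed simp
    \<comment> \<open>Otherwise the lower bound \<open>a 0 * t ^ m\<close> would outgrow
      \<open>C * (\<rho>\<^sup>2) ^ m\<close>, whatever \<open>C\<close> is.\<close>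
    have "t \<le> \<rho>\<^sup>2"
    proof (rule ccontr)
      assume "\<not> t \<le> \<rho>\<^sup>2"
      then have "1 < t / \<rho>\<^sup>2" using \<rho> by (simp add: divide_simps)
      then obtain m where "C / a 0 < (t / \<rho>\<^sup>2) ^ m"
        using real_arch_pow by blast
      moreover have "(t / \<rho>\<^sup>2) ^ m \<le> C / a 0"
        using order_trans[OF growth[of m] bound[of m]] a0 \<rho>
        by (simp add: power_divide divide_simps mult.commute)
      ultimately show False by simp
    qed
    then show ?thesis using a0 by (simp add: t_def divide_simps)
  qed
  then have "(nrm (T f))\<^sup>2 \<le> (\<rho> * nrm f)\<^sup>2"
    by (simp add: a_def nrm_power2 power_mult_distrib)
  then show ?thesis using \<rho> by (auto intro: power2_le_imp_le)
qed

text \<open>For a symmetric operator the norm is bounded by the numerical radius, by polarisation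
  between \<open>f\<close> and \<open>T f\<close>. The invariant subspace \<open>V\<close> allows
  its use both on all bounded functions and on the centred ones.\<close>

lemma numerical_radius_imp_contraction:
  assumes T: "sym_op M T" and \<rho>: "0 < \<rho>"
    and V: "V \<subseteq> bdd_fun M" "\<And>f. f \<in> V \<Longrightarrow> T f \<in> V"
      "\<And>f g c. f \<in> V \<Longrightarrow> g \<in> V \<Longrightarrow> (\<lambda>x. f x + c * g x) \<in> V"
    and radius: "\<And>f. f \<in> V \<Longrightarrow> \<bar>ip M f (T f)\<bar> \<le> \<rho> * ip M f f"
    and f: "f \<in> V"
  shows "nrm (T f) \<le> \<rho> * nrm f"
proof -
  define g where "g = T f"
  have [simp]: "f \<in> bdd_fun M" "g \<in> bdd_fun M" "T g \<in> bdd_fun M" "g \<in> V"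
    using f V unfolding g_def by blast+
  define X where "X = ip M g g"
  have quad: "ip M (\<lambda>x. f x + c * g x) (\<lambda>x. f x + c * g x) = ip M f f + 2 * c * ip M f g + c\<^sup>2 * X" for c
    using ip_commute[of M g f]
    by (simp add: ip_add X_def bdd_fun_mult algebra_simps power2_eq_square)
  have Tlin: "T (\<lambda>x. f x + c * g x) = (\<lambda>x. g x + c * T g x)" for c
    using T unfolding sym_op_def by (simp add: g_def[symmetric] bdd_fun_mult)
  have fTg: "ip M f (T g) = X"
    using T unfolding sym_op_def by (simp add: g_def[symmetric] X_def)
  have quadT: "ip M (\<lambda>x. f x + c * g x) (T (\<lambda>x. f x + c * g x)) = ip M f g + 2 * c * X + c\<^sup>2 * ip M g (T g)" for c
    unfolding Tlin using fTg
    by (simp add: ip_add bdd_fun_mult algebra_simps power2_eq_square) (simp add: X_def)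
  have r: "\<bar>ip M f g + 2 * c * X + c\<^sup>2 * ip M g (T g)\<bar> \<le> \<rho> * (ip M f f + 2 * c * ip M f g + c\<^sup>2 * X)" for c
    using radius[OF V(3)[OF f \<open>g \<in> V\<close>], of c] unfolding quad quadT .
  \<comment> \<open>The bounds at \<open>f + i g\<close> and \<open>f - i g\<close>, added up,
    cancel the terms in \<open>ip M f g\<close> and leave \<open>4 * i * X\<close> on the left. With
    \<open>i = 1 / \<rho>\<close> the \<open>X\<close> on the right costs only half of that.\<close>
  define i where "i = 1 / \<rho>"
  have "4 * i * X \<le> \<rho> * (ip M f f + 2 * i * ip M f g + i\<^sup>2 * X)
      + \<rho> * (ip M f f + 2 * (- i) * ip M f g + (- i)\<^sup>2 * X)"
    using r[of i] r[of "- i"] unfolding abs_le_iff power2_minus by linarith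
  also have "\<dots> = 2 * \<rho> * ip M f f + 2 * (\<rho> * i) * i * X"
    by (simp add: algebra_simps power2_eq_square)
  also have "\<dots> = 2 * \<rho> * ip M f f + 2 * i * X"
    using \<rho> by (simp add: i_def)
  finally have "i * X \<le> \<rho> * ip M f f" by (simp add: mult.commute)
  then have "X \<le> \<rho>\<^sup>2 * ip M f f"
    using \<rho> by (simp add: i_def field_simps power2_eq_square)
  then have "(nrm (T f))\<^sup>2 \<le> (\<rho> * nrm f)\<^sup>2"
    by (simp add: nrm_power2 power_mult_distrib X_def g_def)
  then show ?thesis using \<rho> by (auto intro: power2_le_imp_le)
qed

text \<open>The intersection of measurable supersets whose measures approach the infimum attains it.
  Cutting it further with a measurable superset \<open>B\<close> cannot lower the measure, so the
  part outside \<open>B\<close> is null.\<close>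

lemma measurable_hull:
  assumes "S \<subseteq> space M"
  obtains A where "A \<in> sets M" "S \<subseteq> A"
    "\<And>B. B \<in> sets M \<Longrightarrow> S \<subseteq> B \<Longrightarrow> AE x in M. x \<in> A \<longrightarrow> x \<in> B"
proof -
  define \<alpha> where "\<alpha> = Inf (measure M ` {A \<in> sets M. S \<subseteq> A})"
  have ne: "measure M ` {A \<in> sets M. S \<subseteq> A} \<noteq> {}" using assms by auto
  have bdd: "bdd_below (measure M ` {A \<in> sets M. S \<subseteq> A})" by (rule bdd_belowI[of _ 0]) auto
  have "\<exists>A. A \<in> sets M \<and> S \<subseteq> A \<and> measure M A < \<alpha> + 1 / real (Suc n)" for n
  proof -
    have "\<alpha> < \<alpha> + 1 / real (Suc n)" by simp
    then show ?thesis
      unfolding \<alpha>_def cInf_less_iff[OF ne bdd] by auto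
  qed
  then obtain A where A: "\<And>n. A n \<in> sets M" "\<And>n. S \<subseteq> A n"
      "\<And>n. measure M (A n) < \<alpha> + 1 / real (Suc n)"
    by metis
  let ?A = "\<Inter>n. A n"
  have sA: "?A \<in> sets M" using A(1) by auto
  have "measure M ?A \<le> \<alpha> + 1 / real (Suc n)" for n
    using finite_measure_mono[of ?A "A n"] A(1,3)[of n] INT_lower[of n UNIV A] by auto
  then have le: "measure M ?A \<le> \<alpha>"
    using LIMSEQ_le_const[of "\<lambda>n. \<alpha> + 1 / real (Suc n)" \<alpha> "measure M ?A"]
      tendsto_add[OF tendsto_const LIMSEQ_inverse_real_of_nat, of \<alpha>]
    by (auto simp: inverse_eq_divide)
  show ?thesis
  proof (rule that)
    show "?A \<in> sets M" "S \<subseteq> ?A" using sA A by auto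
    fix B assume B: "B \<in> sets M" "S \<subseteq> B"
    have "\<alpha> \<le> measure M (?A \<inter> B)"
      unfolding \<alpha>_def using B sA A(2) by (intro cInf_lower bdd imageI) auto
    moreover have "measure M (?A - B) = measure M ?A - measure M (?A \<inter> B)"
      using finite_measure_Diff[of ?A "?A \<inter> B"] sA B by (simp add: Diff_Int)
    ultimately have "measure M (?A - B) = 0" using le measure_nonneg[of M "?A - B"] by simp
    then have "?A - B \<in> null_sets M"
      using sA B by (auto simp: null_sets_def emeasure_eq_measure)
    then show "AE x in M. x \<in> ?A \<longrightarrow> x \<in> B"
      by (rule AE_I') auto
  qed
qed

end

section \<open>From pointwise decay to a contraction on centred functions\<close>

context prob_space
begin

lemma nrm_one [simp]: "nrm (\<lambda>x. 1) = 1"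
  by (simp add: nrm_def ip_def prob_space)

lemma integral_abs_le_nrm: "f \<in> bdd_fun M \<Longrightarrow> (LINT x|M. \<bar>f x\<bar>) \<le> nrm f"
  using abs_ip_le[of "\<lambda>x. \<bar>f x\<bar>" "\<lambda>x. 1"] by (simp add: ip_def nrm_def)

text \<open>Integration is the inner product with the constant \<open>1\<close>, and symmetry moves
  \<open>T\<close> onto this fixed vector.\<close>

lemma sym_op_integral:
  assumes "sym_op M T" "T (\<lambda>x. 1) = (\<lambda>x. 1)" "f \<in> bdd_fun M"
  shows "(LINT x|M. T f x) = (LINT x|M. f x)"
proof -
  have "ip M (\<lambda>x. 1) (T f) = ip M (T (\<lambda>x. 1)) f"
    using assms by (simp add: sym_op_def)
  then show ?thesis using assms(2) by (simp add: ip_def)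
qed

lemma sym_op_funpow_bdd_fun: "sym_op M T \<Longrightarrow> f \<in> bdd_fun M \<Longrightarrow> (T ^^ m) f \<in> bdd_fun M"
  by (induction m) (auto simp: sym_op_def)

lemma sym_op_funpow_integral:
  assumes "sym_op M T" "T (\<lambda>x. 1) = (\<lambda>x. 1)" "f \<in> bdd_fun M"
  shows "(LINT x|M. (T ^^ m) f x) = (LINT x|M. f x)"
  using assms by (induction m) (simp_all add: sym_op_integral sym_op_funpow_bdd_fun)

lemma sym_op_diff:
  assumes "sym_op M T" "f \<in> bdd_fun M" "g \<in> bdd_fun M"
  shows "T (\<lambda>x. f x - g x) = (\<lambda>x. T f x - T g x)"
proof -
  have "T (\<lambda>x. f x + (-1) * g x) = (\<lambda>x. T f x + T (\<lambda>x. (-1) * g x) x)"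
    using assms by (intro sym_opD(3) bdd_fun_mult) auto
  also have "T (\<lambda>x. (-1) * g x) = (\<lambda>x. (-1) * T g x)"
    using assms by (intro sym_opD(2))
  finally show ?thesis by simp
qed

lemma nrm_eq_sqrt_integral: "nrm f = sqrt (LINT x|M. (f x)\<^sup>2)"
  by (simp add: nrm_def ip_def power2_eq_square)

text \<open>The rate function \<open>C\<close> need not be measurable. For each fixed \<open>f\<close> the decay bound cuts out a
  measurable set, so it extends from \<open>{C \<le> n}\<close> to a measurable hull of that set.\<close>

lemma ergodic_imp_contraction:
  fixes C :: "'a \<Rightarrow> real"
  assumes T: "sym_op M T" and one: "T (\<lambda>x. 1) = (\<lambda>x. 1)"
    and contr: "\<And>f. f \<in> bdd_fun M \<Longrightarrow> nrm (T f) \<le> nrm f" and \<rho>: "0 < \<rho>"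
    and erg: "AE x in M. \<forall>m f B. f \<in> bdd_fun M \<longrightarrow> (LINT y|M. f y) = 0 \<longrightarrow>
        (\<forall>y. \<bar>f y\<bar> \<le> B) \<longrightarrow> \<bar>(T ^^ m) f x\<bar> \<le> C x * B * \<rho> ^ m"
    and g: "g \<in> bdd_fun M" "(LINT x|M. g x) = 0"
  shows "nrm (T g) \<le> \<rho> * nrm g"
proof -
  define P where "P x \<longleftrightarrow> (\<forall>m f B. f \<in> bdd_fun M \<longrightarrow> (LINT y|M. f y) = 0 \<longrightarrow>
        (\<forall>y. \<bar>f y\<bar> \<le> B) \<longrightarrow> \<bar>(T ^^ m) f x\<bar> \<le> C x * B * \<rho> ^ m)" for x
  define S where "S n = {x\<in>space M. P x \<and> C x \<le> real n}" for n
  have "\<exists>A. A \<in> sets M \<and> S n \<subseteq> A \<and>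
      (\<forall>B\<in>sets M. S n \<subseteq> B \<longrightarrow> (AE x in M. x \<in> A \<longrightarrow> x \<in> B))" for n
    by (rule measurable_hull[of "S n"]) (auto simp: S_def)
  then obtain H where H [measurable]: "\<And>n. H n \<in> sets M" and HS: "\<And>n. S n \<subseteq> H n"
    and hull: "\<And>n B. B \<in> sets M \<Longrightarrow> S n \<subseteq> B \<Longrightarrow> AE x in M. x \<in> H n \<longrightarrow> x \<in> B"
    by metis
  \<comment> \<open>Finite unions make the hulls increase with \<open>n\<close>; they exhaust almost
    all points because almost every \<open>x\<close> lies in some \<open>S n\<close>.\<close>
  define A where "A n = (\<Union>i\<le>n. H i)" for n
  have A [measurable]: "A n \<in> sets M" for n by (auto simp: A_def)
  have cover: "AE x in M. \<exists>n. \<forall>k\<ge>n. x \<in> A k"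
    using erg AE_space
  proof eventually_elim
    case (elim x)
    then have "x \<in> S (nat \<lceil>C x\<rceil>)"
      by (auto simp: S_def P_def real_nat_ceiling_ge)
    then show ?case using HS by (auto simp: A_def intro!: exI[of _ "nat \<lceil>C x\<rceil>"])
  qed
  obtain B where B: "0 \<le> B" "\<And>x. \<bar>g x\<bar> \<le> B" by (rule bdd_funE[OF g(1)]) auto
  \<comment> \<open>\<open>g\<close> is cut off to \<open>A n\<close>, where the decay holds with
    constant \<open>n\<close>, and then recentred, because the hypothesis speaks of centred
    functions only.\<close>
  define h where "h n x = indicator (A n) x * g x" for n x
  define c where "c n = (LINT x|M. h n x)" for n
  define f where "f n x = h n x - c n" for n x
  have h: "h n \<in> bdd_fun M" for n unfolding h_def using g A by (intro bdd_fun_mult) auto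
  have f: "f n \<in> bdd_fun M" for n unfolding f_def using h by auto
  have hB: "\<bar>h n x\<bar> \<le> B" for n x using B by (auto simp: h_def indicator_def)
  have "\<bar>c n\<bar> \<le> (LINT x|M. B)" for n
    unfolding c_def using h hB by (intro integral_abs_bound[THEN order_trans] integral_mono) auto
  then have cB: "\<bar>c n\<bar> \<le> B" for n by (simp add: prob_space)
  have fB: "\<bar>f n x\<bar> \<le> 2 * B" for n x
    using hB[of n x] cB[of n] unfolding f_def by linarith
  have f0: "(LINT x|M. f n x) = 0" for n
    unfolding f_def using h by (simp add: c_def prob_space)
  have contr_f: "nrm (T (f n)) \<le> \<rho> * nrm (f n)" for n
  proof (rule sym_op_decay_imp_contraction[OF T f \<rho>])
    fix m
    let ?F = "(T ^^ m) (f n)"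
    define b where "b = real n * (2 * B) * \<rho> ^ m"
    have b: "b \<ge> 0" using B \<rho> by (simp add: b_def)
    have F: "?F \<in> bdd_fun M" by (rule sym_op_funpow_bdd_fun[OF T f])
    then have [measurable]: "?F \<in> borel_measurable M" by (rule bdd_fun_measurable)
    have "AE x in M. x \<in> H i \<longrightarrow> \<bar>?F x\<bar> \<le> b" if "i \<le> n" for i
    proof -
      have "S i \<subseteq> {x\<in>space M. \<bar>?F x\<bar> \<le> b}"
      proof
        fix x assume x: "x \<in> S i"
        then have "\<bar>?F x\<bar> \<le> C x * (2 * B) * \<rho> ^ m"
          using f f0 fB by (auto simp: S_def P_def)
        also have "\<dots> \<le> b"
          unfolding b_def using x that B \<rho> by (intro mult_right_mono) (auto simp: S_def)
        finally show "x \<in> {x\<in>space M. \<bar>?F x\<bar> \<le> b}" using x by (simp add: S_def)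
      qed
      from hull[OF _ this] show ?thesis by simp
    qed
    then have "AE x in M. \<forall>i\<in>{..n}. x \<in> H i \<longrightarrow> \<bar>?F x\<bar> \<le> b"
      by (subst AE_finite_all) auto
    then have ae: "AE x in M. \<bar>h n x * ?F x\<bar> \<le> B * b"
    proof eventually_elim
      case (elim x)
      show ?case
      proof (cases "x \<in> A n")
        case True
        then have "\<bar>?F x\<bar> \<le> b" using elim by (auto simp: A_def)
        then show ?thesis using hB[of n x] B by (simp add: abs_mult mult_mono)
      qed (use B b in \<open>simp add: h_def\<close>)
    qed
    \<comment> \<open>Only the cut-off part \<open>h n\<close> is tested: the constant
      \<open>c n\<close> drops out because \<open>?F\<close> has mean zero. Hence a bound on
      \<open>?F\<close> inside \<open>A n\<close> is enough.\<close>
    have "ip M (f n) ?F = ip M (h n) ?F - c n * (LINT x|M. ?F x)"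
    proof -
      have "ip M (f n) ?F = ip M (h n) ?F - ip M (\<lambda>x. c n) ?F"
        using ip_diff(1)[OF h bdd_fun_const F, of n "c n"] by (simp add: f_def[abs_def])
      then show ?thesis by (simp add: ip_def)
    qed
    also have "\<dots> = ip M (h n) ?F"
      using sym_op_funpow_integral[OF T one f] f0 by simp
    finally have "\<bar>ip M (f n) ?F\<bar> \<le> (LINT x|M. \<bar>h n x * ?F x\<bar>)"
      by (simp add: ip_def integral_abs_bound)
    also have "\<dots> \<le> (LINT x|M. B * b)"
      using ae h F by (intro integral_mono_AE) auto
    finally show "\<bar>ip M (f n) ?F\<bar> \<le> (B * real n * (2 * B)) * \<rho> ^ m"
      by (simp add: prob_space b_def mult_ac)
  qed
  \<comment> \<open>The remainder \<open>d n\<close> is handled by plain contractivity of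
    \<open>T\<close> and vanishes in norm by dominated convergence.\<close>
  define d where "d n x = g x - f n x" for n x
  have d: "d n \<in> bdd_fun M" for n unfolding d_def using g f by auto
  have hg: "AE x in M. (\<lambda>n. h n x) \<longlonglongrightarrow> g x"
    using cover
  proof eventually_elim
    case (elim x)
    then obtain k where "\<forall>n\<ge>k. x \<in> A n" by auto
    then have "\<forall>\<^sub>F n in sequentially. h n x = g x"
      by (auto simp: eventually_sequentially h_def intro!: exI[of _ k])
    then show ?case by (rule tendsto_eventually)
  qed
  have "c \<longlonglongrightarrow> (LINT x|M. g x)"
    unfolding c_def[abs_def]
    by (rule integral_dominated_convergence[where w="\<lambda>x. B"])
      (use g h hg hB in \<open>auto simp: bdd_fun_measurable\<close>)
  then have c0: "c \<longlonglongrightarrow> 0" using g by simp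
  have "(\<lambda>n. LINT x|M. (d n x)\<^sup>2) \<longlonglongrightarrow> (LINT x|M. 0)"
  proof (rule integral_dominated_convergence[where w="\<lambda>x. (3 * B)\<^sup>2"])
    show "AE x in M. (\<lambda>n. (d n x)\<^sup>2) \<longlonglongrightarrow> 0"
      using hg
    proof eventually_elim
      case (elim x)
      have "(\<lambda>n. (g x - (h n x - c n))\<^sup>2) \<longlonglongrightarrow> (g x - (g x - 0))\<^sup>2"
        by (intro tendsto_intros elim c0)
      then show ?case by (simp add: d_def f_def)
    qed
    show "AE x in M. norm ((d n x)\<^sup>2) \<le> (3 * B)\<^sup>2" for n
    proof (rule AE_I2)
      fix x
      have "\<bar>d n x\<bar> \<le> \<bar>3 * B\<bar>" using fB[of n x] B(2)[of x] unfolding d_def by linarith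
      then show "norm ((d n x)\<^sup>2) \<le> (3 * B)\<^sup>2" unfolding abs_le_square_iff by simp
    qed
  qed (use d in \<open>auto simp: bdd_fun_measurable\<close>)
  then have d0: "(\<lambda>n. nrm (d n)) \<longlonglongrightarrow> 0"
    unfolding nrm_eq_sqrt_integral using tendsto_real_sqrt by fastforce
  have "nrm (T g) \<le> \<rho> * nrm g + (\<rho> + 1) * nrm (d n)" for n
  proof -
    have geq: "g = (\<lambda>x. f n x + d n x)" by (simp add: d_def)
    have Tb: "T (f n) \<in> bdd_fun M" "T (d n) \<in> bdd_fun M"
      using T f d by (auto simp: sym_op_def)
    have "nrm (T g) = nrm (\<lambda>x. T (f n) x + T (d n) x)"
      by (subst geq) (use T f d in \<open>simp add: sym_op_def\<close>)
    also have "\<dots> \<le> nrm (T (f n)) + nrm (T (d n))"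
      by (rule nrm_triangle[OF Tb])
    also have "\<dots> \<le> \<rho> * nrm (f n) + nrm (d n)"
      by (intro add_mono contr_f contr d)
    also have "nrm (f n) = nrm (\<lambda>x. g x + (-1) * d n x)" by (simp add: d_def)
    also have "\<dots> \<le> nrm g + nrm (\<lambda>x. (-1) * d n x)"
      using g d by (intro nrm_triangle bdd_fun_mult) auto
    also have "nrm (\<lambda>x. (-1) * d n x) = nrm (d n)"
      by (simp add: nrm_def ip_def)
    finally show ?thesis using \<rho> by (simp add: algebra_simps)
  qed
  moreover have "(\<lambda>n. \<rho> * nrm g + (\<rho> + 1) * nrm (d n)) \<longlonglongrightarrow> \<rho> * nrm g + (\<rho> + 1) * 0"
    by (intro tendsto_intros d0)
  ultimately show ?thesis
    using LIMSEQ_le_const by fastforce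
qed

section \<open>Splitting off a smoothing part\<close>

text \<open>A nonnegative \<open>f\<close> is split into its mean \<open>c\<close> and a centred
  part \<open>g\<close>. The gap shrinks the contribution of \<open>g\<close>, and removing
  \<open>K\<close> shrinks that of \<open>c\<close>, since \<open>K\<close> has positive total mass
  \<open>k\<close>. Subtracting only a fraction \<open>s\<close> of \<open>ip M f (K f)\<close>
  keeps the other terms below the gap. Positivity of \<open>R\<close> then extends the bound to
  signed functions.\<close>

lemma residual_contraction:
  assumes T: "sym_op M T" and R: "sym_op M R" and K: "sym_op M K"
    and split: "\<And>f. f \<in> bdd_fun M \<Longrightarrow> T f = (\<lambda>x. R f x + K f x)"
    and Rpos: "\<And>f x. f \<in> bdd_fun M \<Longrightarrow> (\<And>y. 0 \<le> f y) \<Longrightarrow> 0 \<le> R f x"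
    and Kpos: "\<And>f x. f \<in> bdd_fun M \<Longrightarrow> (\<And>y. 0 \<le> f y) \<Longrightarrow> 0 \<le> K f x"
    and Kbound: "\<And>f x. f \<in> bdd_fun M \<Longrightarrow> \<bar>K f x\<bar> \<le> (LINT y|M. \<bar>f y\<bar>)"
    and K1: "0 < (LINT x|M. K (\<lambda>x. 1) x)"
    and one: "T (\<lambda>x. 1) = (\<lambda>x. 1)"
    and gap: "\<And>f. f \<in> bdd_fun M \<Longrightarrow> (LINT x|M. f x) = 0 \<Longrightarrow> ip M f (T f) \<le> \<rho> * ip M f f"
    and \<rho>: "0 < \<rho>" "\<rho> < 1"
  obtains r where "0 < r" "r < 1" "\<And>f. f \<in> bdd_fun M \<Longrightarrow> nrm (R f) \<le> r * nrm f"
proof -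
  have b: "T f \<in> bdd_fun M" "R f \<in> bdd_fun M" "K f \<in> bdd_fun M" if "f \<in> bdd_fun M" for f
    using T R K that by (auto simp: sym_op_def)
  have Kip: "\<bar>ip M g (K f)\<bar> \<le> nrm g * nrm f" if fg: "f \<in> bdd_fun M" "g \<in> bdd_fun M" for f g
  proof -
    have "\<bar>ip M g (K f)\<bar> \<le> (LINT x|M. \<bar>g x * K f x\<bar>)"
      by (simp add: ip_def integral_abs_bound)
    also have "\<dots> \<le> (LINT x|M. \<bar>g x\<bar> * (LINT y|M. \<bar>f y\<bar>))"
      using b fg Kbound[OF fg(1)] by (intro integral_mono) (auto simp: abs_mult mult_left_mono)
    also have "\<dots> = (LINT x|M. \<bar>g x\<bar>) * (LINT y|M. \<bar>f y\<bar>)"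
      by simp
    also have "\<dots> \<le> nrm g * nrm f"
      using fg by (intro mult_mono integral_abs_le_nrm) auto
    finally show ?thesis .
  qed
  define k where "k = (LINT x|M. K (\<lambda>x. 1) x)"
  have k_ip: "ip M (\<lambda>x. 1) (K (\<lambda>x. 1)) = k" by (simp add: ip_def k_def)
  have k: "0 < k" "k \<le> 1" using K1 Kip[of "\<lambda>x. 1" "\<lambda>x. 1"] k_ip by (auto simp: k_def)
  \<comment> \<open>\<open>s\<close> is chosen so that the loss \<open>s * (2 / k + 1)\<close> on
    the centred part uses up exactly half of the gap \<open>1 - \<rho>\<close>.\<close>
  define s where "s = (1 - \<rho>) / (2 * (2 / k + 1))"
  have s: "0 < s" "s < 1" "s * (2 / k + 1) = (1 - \<rho>) / 2"
  proof -
    have "(1 - \<rho>) * k \<le> 1 * k" using \<rho> k by (intro mult_right_mono) auto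
    then have "(1 - \<rho>) * k < 4 + 2 * k" using k by linarith
    then show "s < 1" using k by (simp add: s_def divide_simps add_pos_pos)
    show "0 < s" "s * (2 / k + 1) = (1 - \<rho>) / 2"
      using \<rho> k by (auto simp: s_def divide_simps add_pos_pos)
  qed
  \<comment> \<open>The two entries are the resulting factors of \<open>c\<^sup>2\<close> and
    \<open>v\<^sup>2\<close>.\<close>
  define r where "r = max (1 - s * k / 2) ((1 + \<rho>) / 2)"
  have r: "0 < r" "r < 1" using \<rho> k s by (auto simp: r_def less_max_iff_disj)
  have radius_pos: "ip M f (R f) \<le> r * ip M f f"
    if f: "f \<in> bdd_fun M" and pos: "\<And>x. 0 \<le> f x" for f
  proof -
    define c where "c = (LINT x|M. f x)"
    define g where "g x = f x - c" for x
    have g: "g \<in> bdd_fun M" "(LINT x|M. g x) = 0"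
      using f by (auto simp: g_def[abs_def] c_def prob_space)
    have fe: "f = (\<lambda>x. g x + c * 1)" by (simp add: g_def)
    have cg: "(\<lambda>x. c * 1) \<in> bdd_fun M" by auto
    have g1: "ip M g (\<lambda>x. 1) = 0" "ip M (\<lambda>x. 1) g = 0" "ip M (\<lambda>x. 1) (T g) = 0"
      using g sym_op_integral[OF T one g(1)] by (simp_all add: ip_def)
    have lin: "L f = (\<lambda>x. L g x + c * L (\<lambda>x. 1) x)" if L: "sym_op M L" for L
    proof -
      have "L (\<lambda>x. g x + c * 1) = (\<lambda>x. L g x + L (\<lambda>x. c * 1) x)"
        by (rule sym_opD(3)[OF L g(1) cg])
      also have "L (\<lambda>x. c * 1) = (\<lambda>x. c * L (\<lambda>x. 1) x)"
        by (rule sym_opD(2)[OF L bdd_fun_const])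
      finally show ?thesis using fe by simp
    qed
    have one1: "ip M (\<lambda>x. 1) (\<lambda>x. 1) = 1" by (simp add: ip_def prob_space)
    have expand: "ip M f (\<lambda>x. u x + c * v x) =
        ip M g u + c * ip M g v + c * ip M (\<lambda>x. 1) u + c\<^sup>2 * ip M (\<lambda>x. 1) v"
      if uv: "u \<in> bdd_fun M" "v \<in> bdd_fun M" for u v
    proof -
      have "ip M f (\<lambda>x. u x + c * v x) = ip M f u + c * ip M f v"
        using f uv by (subst ip_add) auto
      also have "ip M f u = ip M g u + c * ip M (\<lambda>x. 1) u"
        by (subst fe) (use g uv cg ip_scale(1)[of M c "\<lambda>x. 1" u] in \<open>simp add: ip_add\<close>)
      also have "ip M f v = ip M g v + c * ip M (\<lambda>x. 1) v"
        by (subst fe) (use g uv cg ip_scale(1)[of M c "\<lambda>x. 1" v] in \<open>simp add: ip_add\<close>)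
      finally show ?thesis by (simp add: algebra_simps power2_eq_square)
    qed
    define v where "v = nrm g"
    have ff: "ip M f f = c\<^sup>2 + v\<^sup>2"
      using expand[of g "\<lambda>x. 1"] g g1 one1 fe by (simp add: v_def nrm_power2)
    have "ip M f (T f) = ip M g (T g) + c\<^sup>2"
      using expand[of "T g" "\<lambda>x. 1"] b g g1 one1 lin[OF T] one by simp
    then have fT: "ip M f (T f) \<le> c\<^sup>2 + \<rho> * v\<^sup>2"
      using gap[OF g] by (simp add: v_def nrm_power2)
    have sym: "ip M (\<lambda>x. 1) (K g) = ip M g (K (\<lambda>x. 1))"
      using K g(1) ip_commute[of M _ g] by (simp add: sym_op_def)
    have "ip M f (K f) = ip M g (K g) + 2 * c * ip M g (K (\<lambda>x. 1)) + c\<^sup>2 * k"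
      using expand[of "K g" "K (\<lambda>x. 1)"] b g lin[OF K] k_ip sym by simp
    moreover have "\<bar>ip M g (K g)\<bar> \<le> v\<^sup>2"
      using Kip[OF g(1) g(1)] by (simp add: v_def power2_eq_square)
    moreover have "\<bar>2 * c * ip M g (K (\<lambda>x. 1))\<bar> \<le> k / 2 * c\<^sup>2 + 2 / k * v\<^sup>2"
    proof -
      have "\<bar>2 * c * ip M g (K (\<lambda>x. 1))\<bar> \<le> 2 * \<bar>c\<bar> * v"
        using Kip[of "\<lambda>x. 1" g] g by (simp add: abs_mult v_def mult_left_mono)
      \<comment> \<open>Young's inequality with weight \<open>k\<close>, so that the cross term
        costs only half of the positive term \<open>c\<^sup>2 * k\<close>.\<close>
      also have "\<dots> \<le> k / 2 * c\<^sup>2 + 2 / k * v\<^sup>2"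
      proof -
        have "0 \<le> (k * \<bar>c\<bar> - 2 * v)\<^sup>2 / (2 * k)" using k by simp
        also have "\<dots> = k / 2 * c\<^sup>2 + 2 / k * v\<^sup>2 - 2 * \<bar>c\<bar> * v"
          using k by (simp add: power2_diff power_mult_distrib field_simps power2_eq_square)
        finally show ?thesis by simp
      qed
      finally show ?thesis .
    qed
    ultimately have fK: "k / 2 * c\<^sup>2 - (2 / k + 1) * v\<^sup>2 \<le> ip M f (K f)"
      unfolding abs_le_iff by (simp add: algebra_simps)
    \<comment> \<open>This is where \<open>f \<ge> 0\<close> enters: it makes the fraction
      \<open>s\<close> of this term a lower bound for the whole term.\<close>
    have "0 \<le> ip M f (K f)"
      unfolding ip_def using f pos Kpos by (intro Bochner_Integration.integral_nonneg mult_nonneg_nonneg) auto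
    then have "s * ip M f (K f) \<le> 1 * ip M f (K f)"
      using s by (intro mult_right_mono) auto
    moreover have "s * (k / 2 * c\<^sup>2 - (2 / k + 1) * v\<^sup>2) \<le> s * ip M f (K f)"
      using fK s by (intro mult_left_mono) auto
    moreover have "s * (k / 2 * c\<^sup>2 - (2 / k + 1) * v\<^sup>2) = s * k / 2 * c\<^sup>2 - (1 - \<rho>) / 2 * v\<^sup>2"
      using s(3) by (metis (no_types, lifting) mult.assoc right_diff_distrib times_divide_eq_right)
    moreover have "ip M f (T f) = ip M f (R f) + ip M f (K f)"
      unfolding split[OF f] using f b by (intro ip_add) auto
    ultimately have "ip M f (R f) \<le> c\<^sup>2 + \<rho> * v\<^sup>2 - (s * k / 2 * c\<^sup>2 - (1 - \<rho>) / 2 * v\<^sup>2)"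
      using fT by linarith
    also have "\<dots> = (1 - s * k / 2) * c\<^sup>2 + ((1 + \<rho>) / 2) * v\<^sup>2"
      by (simp add: field_simps)
    also have "\<dots> \<le> r * c\<^sup>2 + r * v\<^sup>2"
      by (intro add_mono mult_right_mono) (auto simp: r_def)
    finally show ?thesis by (simp add: ff algebra_simps)
  qed
  have radius: "\<bar>ip M f (R f)\<bar> \<le> r * ip M f f" if f: "f \<in> bdd_fun M" for f
  proof -
    have absR: "\<bar>R f x\<bar> \<le> R (\<lambda>x. \<bar>f x\<bar>) x" for x
    proof -
      have "0 \<le> R (\<lambda>x. \<bar>f x\<bar> - f x) x" "0 \<le> R (\<lambda>x. \<bar>f x\<bar> + f x) x"
        using f by (auto intro!: Rpos)
      moreover have "R (\<lambda>x. \<bar>f x\<bar> + f x) = (\<lambda>x. R (\<lambda>x. \<bar>f x\<bar>) x + R f x)"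
        by (rule sym_opD(3)[OF R bdd_fun_abs[OF f] f])
      ultimately show ?thesis
        using sym_op_diff[OF R bdd_fun_abs[OF f] f] by simp
    qed
    have "\<bar>ip M f (R f)\<bar> \<le> (LINT x|M. \<bar>f x * R f x\<bar>)"
      by (simp add: ip_def integral_abs_bound)
    also have "\<dots> \<le> ip M (\<lambda>x. \<bar>f x\<bar>) (R (\<lambda>x. \<bar>f x\<bar>))"
      unfolding ip_def using f b absR by (intro integral_mono) (auto simp: abs_mult mult_left_mono)
    also have "\<dots> \<le> r * ip M (\<lambda>x. \<bar>f x\<bar>) (\<lambda>x. \<bar>f x\<bar>)"
      using f by (intro radius_pos) auto
    finally show ?thesis by (simp add: ip_def)
  qed
  have "nrm (R f) \<le> r * nrm f" if "f \<in> bdd_fun M" for f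
    by (rule numerical_radius_imp_contraction[OF R r(1) order.refl])
      (use b radius that in \<open>auto intro!: bdd_fun_add bdd_fun_mult\<close>)
  with r show ?thesis by (rule that)
qed


text \<open>Positivity propagates through the induction:
  \<open>B * (R ^^ m) (\<lambda>x. 1) x\<close> plus or minus \<open>(R ^^ m) f x\<close> stays
  nonnegative.\<close>

lemma sym_op_funpow_abs_le:
  assumes R: "sym_op M R"
    and Rpos: "\<And>f x. f \<in> bdd_fun M \<Longrightarrow> (\<And>y. 0 \<le> f y) \<Longrightarrow> 0 \<le> R f x"
    and f: "f \<in> bdd_fun M" and B: "\<And>x. \<bar>f x\<bar> \<le> B"
  shows "\<bar>(R ^^ m) f x\<bar> \<le> B * (R ^^ m) (\<lambda>x. 1) x"
proof (induction m arbitrary: x)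
  case (Suc m)
  define u where "u = (\<lambda>x. B * (R ^^ m) (\<lambda>x. 1) x)"
  define v where "v = (R ^^ m) f"
  have v: "v \<in> bdd_fun M" unfolding v_def by (rule sym_op_funpow_bdd_fun[OF R f])
  have 1: "(R ^^ m) (\<lambda>x. 1) \<in> bdd_fun M" by (rule sym_op_funpow_bdd_fun[OF R bdd_fun_const])
  then have u: "u \<in> bdd_fun M" unfolding u_def by (intro bdd_fun_mult) auto
  have vu: "0 \<le> u x - v x" "0 \<le> u x + v x" for x
    using Suc.IH[of x] by (simp_all add: u_def v_def abs_le_iff)
  have "0 \<le> R (\<lambda>x. u x - v x) x" "0 \<le> R (\<lambda>x. u x + v x) x"
    using u v vu by (intro Rpos; blast)+
  then have "\<bar>R v x\<bar> \<le> R u x"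
    by (simp add: sym_op_diff[OF R u v] sym_opD(3)[OF R u v] abs_le_iff)
  also have "R u x = B * R ((R ^^ m) (\<lambda>x. 1)) x"
    unfolding u_def by (simp add: sym_opD(2)[OF R 1])
  finally show ?case by (simp add: v_def)
qed (use B in simp)

text \<open>The words in \<open>R\<close> and \<open>K\<close> that make up \<open>T ^^ m\<close>
  are sorted by the last application of \<open>K\<close>: after it come \<open>j\<close> factors
  \<open>R\<close>, and everything before it is a full power of \<open>T\<close>.\<close>

lemma funpow_residual_expansion:
  assumes T: "sym_op M T" and R: "sym_op M R" and K: "sym_op M K"
    and split: "\<And>f. f \<in> bdd_fun M \<Longrightarrow> T f = (\<lambda>x. R f x + K f x)"
    and f: "f \<in> bdd_fun M"
  shows "(T ^^ m) f x = (R ^^ m) f x + (\<Sum>j<m. (R ^^ j) (K ((T ^^ (m - Suc j)) f)) x)"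
  using f
proof (induction m arbitrary: f)
  case (Suc m)
  have b: "T f \<in> bdd_fun M" "R f \<in> bdd_fun M" "K f \<in> bdd_fun M"
    using T R K Suc.prems by (auto simp: sym_op_def)
  have add: "(R ^^ n) (\<lambda>x. u x + v x) = (\<lambda>x. (R ^^ n) u x + (R ^^ n) v x)"
    if "u \<in> bdd_fun M" "v \<in> bdd_fun M" for n u v
    using that by (induction n) (simp_all add: sym_opD(3)[OF R] sym_op_funpow_bdd_fun[OF R])
  have "(T ^^ Suc m) f x = (T ^^ m) (T f) x"
    by (simp add: funpow_swap1)
  also have "\<dots> = (R ^^ m) (T f) x + (\<Sum>j<m. (R ^^ j) (K ((T ^^ (m - Suc j)) (T f))) x)"
    by (rule Suc.IH[OF b(1)])
  also have "(R ^^ m) (T f) x = (R ^^ Suc m) f x + (R ^^ m) (K f) x"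
    unfolding split[OF Suc.prems] using add[OF b(2,3), of m] by (simp add: funpow_swap1)
  also have "(\<Sum>j<m. (R ^^ j) (K ((T ^^ (m - Suc j)) (T f))) x) =
      (\<Sum>j<m. (R ^^ j) (K ((T ^^ (Suc m - Suc j)) f)) x)"
  proof (rule sum.cong)
    fix j assume "j \<in> {..<m}"
    then have "Suc m - Suc j = Suc (m - Suc j)" by auto
    then show "(R ^^ j) (K ((T ^^ (m - Suc j)) (T f))) x = (R ^^ j) (K ((T ^^ (Suc m - Suc j)) f)) x"
      by (simp only: funpow_Suc_right comp_apply)
  qed simp
  finally show ?case by simp
qed simp

text \<open>The remainder in \<open>funpow_residual_expansion\<close> is controlled pointwise by the iterates of \<open>R\<close> on
  the constant function, while \<open>K\<close> turns the \<open>L\<^sup>2\<close> decay of the iterates of \<open>T\<close> into uniform decay.\<close>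

lemma residual_contraction_imp_pointwise_decay:
  assumes T: "sym_op M T" and R: "sym_op M R" and K: "sym_op M K"
    and split: "\<And>f. f \<in> bdd_fun M \<Longrightarrow> T f = (\<lambda>x. R f x + K f x)"
    and Rpos: "\<And>f x. f \<in> bdd_fun M \<Longrightarrow> (\<And>y. 0 \<le> f y) \<Longrightarrow> 0 \<le> R f x"
    and Kbound: "\<And>f x. f \<in> bdd_fun M \<Longrightarrow> \<bar>K f x\<bar> \<le> (LINT y|M. \<bar>f y\<bar>)"
    and one: "T (\<lambda>x. 1) = (\<lambda>x. 1)"
    and contr: "\<And>f. f \<in> bdd_fun M \<Longrightarrow> (LINT x|M. f x) = 0 \<Longrightarrow> nrm (T f) \<le> \<rho> * nrm f"
    and Rcontr: "\<And>f. f \<in> bdd_fun M \<Longrightarrow> nrm (R f) \<le> r * nrm f"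
    and \<rho>: "0 < \<rho>" "\<rho> < 1" and r: "0 < r" "r < 1"
  obtains s C where "0 < s" "s < 1"
    "AE x in M. \<forall>m f. f \<in> bdd_fun M \<longrightarrow> (LINT y|M. f y) = 0 \<longrightarrow> (\<forall>y. \<bar>f y\<bar> \<le> 1) \<longrightarrow>
        \<bar>(T ^^ m) f x\<bar> \<le> C x * s ^ m"
proof -
  \<comment> \<open>The room between \<open>r\<close> and \<open>s\<close> makes the series
    \<open>D\<close> below converge; the room between \<open>\<rho>\<close> and \<open>s\<close>
    bounds the convolution sum at the end.\<close>
  define s where "s = (max \<rho> r + 1) / 2"
  have s: "0 < s" "s < 1" "\<rho> < s" "r < s" using \<rho> r by (auto simp: s_def)
  define u where "u m = (R ^^ m) (\<lambda>x. 1)" for m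
  have u: "u m \<in> bdd_fun M" for m
    unfolding u_def by (rule sym_op_funpow_bdd_fun[OF R bdd_fun_const])
  note [measurable] = bdd_fun_measurable[OF u]
  have u_nrm: "nrm (u m) \<le> r ^ m" for m
  proof (induction m)
    case (Suc m)
    have "nrm (R (u m)) \<le> r * nrm (u m)" by (rule Rcontr[OF u])
    also have "\<dots> \<le> r * r ^ m" using Suc r by (intro mult_left_mono) auto
    finally show ?case by (simp add: u_def)
  qed (simp add: u_def)
  \<comment> \<open>Summing squares turns norm decay into pointwise decay: the integral of
    \<open>D\<close> is dominated by a geometric series with ratio \<open>(r / s)\<^sup>2\<close>,
    so \<open>D\<close> is finite almost everywhere, and it dominates each of its terms.\<close>
  define D where "D x = (\<Sum>m. ennreal ((u m x / s ^ m)\<^sup>2))" for x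
  have "(\<integral>\<^sup>+x. D x \<partial>M) = (\<Sum>m. \<integral>\<^sup>+x. ennreal ((u m x / s ^ m)\<^sup>2) \<partial>M)"
    unfolding D_def by (rule nn_integral_suminf) measurable
  also have "\<dots> \<le> (\<Sum>m. ennreal (((r / s)\<^sup>2) ^ m))"
  proof (rule suminf_le[OF _ summableI summableI])
    fix m
    have "(\<lambda>x. (u m x / s ^ m)\<^sup>2) \<in> bdd_fun M"
      using u[of m] bdd_fun_mult[OF bdd_fun_const bdd_fun_mult[OF u[of m] u[of m]], of "1 / (s ^ m)\<^sup>2"]
      by (simp add: power_divide power2_eq_square)
    then have "(\<integral>\<^sup>+x. ennreal ((u m x / s ^ m)\<^sup>2) \<partial>M) = ennreal (LINT x|M. (u m x / s ^ m)\<^sup>2)"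
      by (intro nn_integral_eq_integral) auto
    also have "(LINT x|M. (u m x / s ^ m)\<^sup>2) = (nrm (u m))\<^sup>2 / (s ^ m)\<^sup>2"
      by (simp add: nrm_power2 ip_def power_divide) (simp add: power2_eq_square)
    also have "\<dots> \<le> (r ^ m)\<^sup>2 / (s ^ m)\<^sup>2"
      using u_nrm[of m] by (intro divide_right_mono power_mono) auto
    also have "\<dots> = ((r / s)\<^sup>2) ^ m"
      by (simp add: power_divide power_mult[symmetric] mult.commute)
    finally show "(\<integral>\<^sup>+x. ennreal ((u m x / s ^ m)\<^sup>2) \<partial>M) \<le> ennreal (((r / s)\<^sup>2) ^ m)"
      by (simp add: ennreal_leI)
  qed
  also have "\<dots> < \<infinity>"
  proof -
    have "\<bar>(r / s)\<^sup>2\<bar> < 1" using r s by (simp add: power_less_one_iff)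
    then have "summable (\<lambda>m. ((r / s)\<^sup>2) ^ m)" by (intro summable_geometric) simp
    then have "(\<Sum>m. ennreal (((r / s)\<^sup>2) ^ m)) = ennreal (\<Sum>m. ((r / s)\<^sup>2) ^ m)"
      by (intro suminf_ennreal2) auto
    then show ?thesis by simp
  qed
  finally have "(\<integral>\<^sup>+x. D x \<partial>M) \<noteq> \<infinity>" by simp
  moreover have "D \<in> borel_measurable M" unfolding D_def[abs_def] by measurable
  ultimately have finite_D: "AE x in M. D x \<noteq> \<infinity>" by (intro nn_integral_PInf_AE)
  define C0 where "C0 x = sqrt (enn2real (D x))" for x
  have u_bound: "u m x \<le> C0 x * s ^ m" if "D x \<noteq> \<infinity>" for m x
  proof -
    have "ennreal ((u m x / s ^ m)\<^sup>2) \<le> D x"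
      unfolding D_def using sum_le_suminf[OF summableI, of "{m}"] by simp
    then have "(u m x / s ^ m)\<^sup>2 \<le> enn2real (D x)"
      using that by (metis ennreal_enn2real_if ennreal_le_iff enn2real_nonneg infinity_ennreal_def)
    then have "\<bar>u m x / s ^ m\<bar> \<le> C0 x"
      unfolding C0_def by (metis real_sqrt_abs real_sqrt_le_mono)
    then have "u m x / s ^ m \<le> C0 x" by (simp only: abs_le_iff)
    then show ?thesis using s by (simp add: divide_simps)
  qed
  have T_nrm: "nrm ((T ^^ n) f) \<le> \<rho> ^ n"
    if f: "f \<in> bdd_fun M" "(LINT y|M. f y) = 0" "\<And>y. \<bar>f y\<bar> \<le> 1" for f n
  proof (induction n)
    case 0
    have "f x * f x \<le> 1" for x
      using f(3)[of x] abs_square_le_1[of "f x"] by (simp add: power2_eq_square)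
    then have "ip M f f \<le> (LINT x|M. 1)"
      unfolding ip_def using f by (intro integral_mono) auto
    then show ?case by (simp add: nrm_def prob_space)
  next
    case (Suc n)
    have "nrm (T ((T ^^ n) f)) \<le> \<rho> * nrm ((T ^^ n) f)"
      using f by (intro contr sym_op_funpow_bdd_fun[OF T]) (auto simp: sym_op_funpow_integral[OF T one])
    also have "\<dots> \<le> \<rho> * \<rho> ^ n" using Suc \<rho> by (intro mult_left_mono) auto
    finally show ?case by simp
  qed
  \<comment> \<open>The exceptional set is that of \<open>D\<close> alone, so it depends on neither
    \<open>m\<close> nor \<open>f\<close>.\<close>
  from finite_D have "AE x in M. \<forall>m f. f \<in> bdd_fun M \<longrightarrow> (LINT y|M. f y) = 0 \<longrightarrow> (\<forall>y. \<bar>f y\<bar> \<le> 1) \<longrightarrow>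
        \<bar>(T ^^ m) f x\<bar> \<le> (C0 x + C0 x / (s - \<rho>)) * s ^ m"
  proof (eventually_elim, intro allI impI)
    fix x m f
    assume Dx: "D x \<noteq> \<infinity>" and f: "f \<in> bdd_fun M" "(LINT y|M. f y) = 0" "\<forall>y. \<bar>f y\<bar> \<le> 1"
    have "\<bar>(R ^^ m) f x\<bar> \<le> C0 x * s ^ m"
      using sym_op_funpow_abs_le[OF R Rpos f(1), of 1 m x] f u_bound[OF Dx, of m] by (simp add: u_def)
    moreover have "\<bar>(R ^^ j) (K ((T ^^ n) f)) x\<bar> \<le> C0 x * (\<rho> ^ n * s ^ j)" for j n
    proof -
      have b: "(T ^^ n) f \<in> bdd_fun M" by (rule sym_op_funpow_bdd_fun[OF T f(1)])
      have "\<bar>K ((T ^^ n) f) y\<bar> \<le> \<rho> ^ n" for y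
        using Kbound[OF b, of y] integral_abs_le_nrm[OF b] T_nrm[of f n] f by simp
      then have "\<bar>(R ^^ j) (K ((T ^^ n) f)) x\<bar> \<le> \<rho> ^ n * u j x"
        unfolding u_def by (intro sym_op_funpow_abs_le[OF R Rpos] sym_opD(1)[OF K b])
      also have "\<dots> \<le> \<rho> ^ n * (C0 x * s ^ j)"
        using \<rho> by (intro mult_left_mono u_bound Dx) auto
      finally show ?thesis by (simp add: mult_ac)
    qed
    then have "\<bar>\<Sum>j<m. (R ^^ j) (K ((T ^^ (m - Suc j)) f)) x\<bar> \<le> (\<Sum>j<m. C0 x * (\<rho> ^ (m - Suc j) * s ^ j))"
      by (intro order_trans[OF sum_abs] sum_mono)
    moreover have "(\<Sum>j<m. C0 x * (\<rho> ^ (m - Suc j) * s ^ j)) \<le> C0 x / (s - \<rho>) * s ^ m"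
    proof -
      \<comment> \<open>The left side factorises \<open>s ^ m - \<rho> ^ m\<close>.\<close>
      have "(s - \<rho>) * (\<Sum>j<m. \<rho> ^ (m - Suc j) * s ^ j) \<le> s ^ m"
        unfolding power_diff_sumr2[symmetric] using \<rho> by simp
      then have "(\<Sum>j<m. \<rho> ^ (m - Suc j) * s ^ j) \<le> s ^ m / (s - \<rho>)"
        using s by (simp add: pos_le_divide_eq mult.commute)
      then have "C0 x * (\<Sum>j<m. \<rho> ^ (m - Suc j) * s ^ j) \<le> C0 x * (s ^ m / (s - \<rho>))"
        by (intro mult_left_mono) (auto simp: C0_def)
      then show ?thesis by (simp add: sum_distrib_left)
    qed
    moreover have "(T ^^ m) f x = (R ^^ m) f x + (\<Sum>j<m. (R ^^ j) (K ((T ^^ (m - Suc j)) f)) x)"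
      by (rule funpow_residual_expansion[OF T R K split f(1)])
    ultimately show "\<bar>(T ^^ m) f x\<bar> \<le> (C0 x + C0 x / (s - \<rho>)) * s ^ m"
      unfolding distrib_right by linarith
  qed
  with s(1,2) show ?thesis by (rule that)
qed

end

section \<open>Kernels with a symmetric flow\<close>

lemma bdd_fun_density [simp]: "bdd_fun (density M f) = bdd_fun M"
  by (simp add: bdd_fun_def)

text \<open>\<open>space mu = UNIV\<close> lets kernel identities be stated for all points of the
  type, without membership conditions.\<close>

locale target_density = sigma_finite_measure mu for mu :: "'a measure" +
  fixes pd :: "'a \<Rightarrow> real"
  assumes space_mu [simp]: "space mu = UNIV"
    and pd_meas [measurable]: "pd \<in> borel_measurable mu"
    and pd_nonneg: "\<And>x. 0 \<le> pd x"
    and pd_mass: "(\<integral>\<^sup>+x. ennreal (pd x) \<partial>mu) = 1"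
begin

definition target :: "'a measure" where
  "target = density mu (\<lambda>x. ennreal (pd x))"

sublocale P: prob_space target
proof (rule prob_spaceI)
  have "emeasure target UNIV = (\<integral>\<^sup>+x. ennreal (pd x) * indicator UNIV x \<partial>mu)"
    unfolding target_def using sets.top[of mu] by (intro emeasure_density) auto
  then show "emeasure target (space target) = 1"
    using pd_mass by (simp add: target_def)
qed

sublocale pair: pair_sigma_finite mu mu ..

lemma bdd_fun_target [simp]: "bdd_fun target = bdd_fun mu"
  by (simp add: target_def)

lemma sets_target [simp, measurable_cong]: "sets target = sets mu"
  by (simp add: target_def)

lemma integral_target: "f \<in> borel_measurable mu \<Longrightarrow> (LINT x|target. f x) = (LINT x|mu. pd x * f x)"
  unfolding target_def by (subst integral_density) (auto simp: pd_nonneg)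

lemma integrable_target: "f \<in> bdd_fun mu \<Longrightarrow> integrable mu (\<lambda>x. pd x * f x)"
proof -
  assume f: "f \<in> bdd_fun mu"
  then have "integrable (density mu (\<lambda>x. ennreal (pd x))) f"
    using P.bdd_fun_integrable[of f] by (simp add: target_def)
  then show ?thesis
    using bdd_fun_measurable[OF f] by (subst (asm) integrable_density) (auto simp: pd_nonneg)
qed

text \<open>The kernel moves with density \<open>a x\<close> and stays with mass \<open>r x\<close>; the total mass may be
  less than one.\<close>

definition sym_kernel :: "('a \<Rightarrow> 'a \<Rightarrow> real) \<Rightarrow> ('a \<Rightarrow> real) \<Rightarrow> bool" where
  "sym_kernel a r \<longleftrightarrow>
    (\<lambda>(x, y). a x y) \<in> borel_measurable (mu \<Otimes>\<^sub>M mu) \<and> r \<in> borel_measurable mu \<and>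
    (\<forall>x y. 0 \<le> a x y) \<and> (\<forall>x. 0 \<le> r x) \<and>
    (\<forall>x. (\<integral>\<^sup>+y. ennreal (a x y) \<partial>mu) + ennreal (r x) \<le> 1) \<and>
    (\<forall>x y. pd x * a x y = pd y * a y x)"

definition kop :: "('a \<Rightarrow> 'a \<Rightarrow> real) \<Rightarrow> ('a \<Rightarrow> real) \<Rightarrow> ('a \<Rightarrow> real) \<Rightarrow> 'a \<Rightarrow> real" where
  "kop a r g x = (LINT y|mu. a x y * g y) + r x * g x"

text \<open>This integrates \<open>F\<close> over pairs of a start drawn from the target and an
  accepted move. The holding mass sits on the diagonal and is left out.\<close>

definition flow :: "('a \<Rightarrow> 'a \<Rightarrow> real) \<Rightarrow> ('a \<times> 'a \<Rightarrow> real) \<Rightarrow> real" where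
  "flow a F = (LINT p|(mu \<Otimes>\<^sub>M mu). pd (fst p) * a (fst p) (snd p) * F p)"

text \<open>Differences vanish on the diagonal, so the holding mass \<open>r\<close> does not enter.
  For kernels of mass one this is the quadratic form of the identity minus
  \<open>kop a r\<close>.\<close>

definition dirichlet :: "('a \<Rightarrow> 'a \<Rightarrow> real) \<Rightarrow> ('a \<Rightarrow> real) \<Rightarrow> real" where
  "dirichlet a g = flow a (\<lambda>p. (g (fst p) - g (snd p))\<^sup>2) / 2"

context
  fixes a r assumes ar: "sym_kernel a r"
begin

lemma sym_kernelD:
  shows "(\<lambda>(x, y). a x y) \<in> borel_measurable (mu \<Otimes>\<^sub>M mu)" "r \<in> borel_measurable mu"
    and "0 \<le> a x y" "0 \<le> r x"
    and "(\<integral>\<^sup>+y. ennreal (a x y) \<partial>mu) + ennreal (r x) \<le> 1"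
    and "pd x * a x y = pd y * a y x"
  using ar by (simp_all add: sym_kernel_def)

lemma kernel_measurable1 [measurable]: "a x \<in> borel_measurable mu"
  using measurable_compose_Pair1[OF _ sym_kernelD(1), of x] by simp

lemma kernel_integrable: "integrable mu (a x)"
proof (rule integrableI_nonneg)
  have "(\<integral>\<^sup>+y. ennreal (a x y) \<partial>mu) \<le> 1"
    using sym_kernelD(5)[of x] by (metis add_increasing2 order.trans le_iff_add)
  then show "(\<integral>\<^sup>+y. ennreal (a x y) \<partial>mu) < \<infinity>"
    using le_less_trans by fastforce
qed (auto simp: sym_kernelD)

lemma kernel_nn_integral: "(\<integral>\<^sup>+y. ennreal (a x y) \<partial>mu) = ennreal (LINT y|mu. a x y)"
  by (rule nn_integral_eq_integral) (auto simp: kernel_integrable sym_kernelD)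

lemma kernel_mass: "(LINT y|mu. a x y) + r x \<le> 1"
proof -
  have "ennreal ((LINT y|mu. a x y) + r x) \<le> ennreal 1"
    using sym_kernelD(5)[of x] sym_kernelD(3,4) kernel_nn_integral[of x]
    by (subst ennreal_plus) auto
  then show ?thesis by (subst (asm) ennreal_le_iff) auto
qed

lemma kernel_integrable_mult:
  assumes "g \<in> bdd_fun mu"
  shows "integrable mu (\<lambda>y. a x y * g y)"
proof -
  obtain B where B: "0 \<le> B" "\<And>x. \<bar>g x\<bar> \<le> B" by (rule bdd_funE[OF assms]) auto
  note [measurable] = bdd_fun_measurable[OF assms]
  show ?thesis
    by (rule Bochner_Integration.integrable_bound[OF integrable_mult_right[OF kernel_integrable[of x], of B]])
      (use B in \<open>auto simp: abs_mult sym_kernelD mult.commute mult_right_mono\<close>)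
qed

lemma kop_pos: "(\<And>y. 0 \<le> f y) \<Longrightarrow> 0 \<le> kop a r f x"
  unfolding kop_def by (intro add_nonneg_nonneg Bochner_Integration.integral_nonneg mult_nonneg_nonneg) (auto simp: sym_kernelD)

lemma kop_add:
  assumes "f \<in> bdd_fun mu" "g \<in> bdd_fun mu"
  shows "kop a r (\<lambda>x. f x + g x) = (\<lambda>x. kop a r f x + kop a r g x)"
  using assms by (simp add: kop_def distrib_left kernel_integrable_mult fun_eq_iff)

lemma kop_scale: "kop a r (\<lambda>x. c * f x) = (\<lambda>x. c * kop a r f x)"
proof
  have "(LINT y|mu. a x y * (c * f y)) = c * (LINT y|mu. a x y * f y)" for x
    by (subst integral_mult_right_zero[symmetric]) (simp add: mult_ac)
  then show "kop a r (\<lambda>x. c * f x) x = c * kop a r f x" for x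
    by (simp add: kop_def algebra_simps)
qed

lemma kop_bdd_fun:
  assumes g: "g \<in> bdd_fun mu"
  shows "kop a r g \<in> bdd_fun mu"
proof -
  obtain B where B: "0 \<le> B" "\<And>x. \<bar>g x\<bar> \<le> B" by (rule bdd_funE[OF g]) auto
  note [measurable] = bdd_fun_measurable[OF g] sym_kernelD(1,2)
  show ?thesis
  proof (rule bdd_funI)
    show "kop a r g \<in> borel_measurable mu"
      unfolding kop_def[abs_def] by measurable
    fix x
    have "\<bar>LINT y|mu. a x y * g y\<bar> \<le> (LINT y|mu. \<bar>a x y * g y\<bar>)"
      by (rule integral_abs_bound)
    also have "\<dots> \<le> (LINT y|mu. a x y * B)"
      using integrable_abs[OF kernel_integrable_mult[OF g, of x]] kernel_integrable[of x] B
      by (intro integral_mono) (auto simp: abs_mult sym_kernelD intro!: mult_left_mono)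
    also have "\<dots> = (LINT y|mu. a x y) * B" by simp
    finally have "\<bar>LINT y|mu. a x y * g y\<bar> \<le> (LINT y|mu. a x y) * B" .
    moreover have "\<bar>r x * g x\<bar> \<le> r x * B"
      using B by (simp add: abs_mult sym_kernelD mult_left_mono)
    ultimately have "\<bar>kop a r g x\<bar> \<le> ((LINT y|mu. a x y) + r x) * B"
      unfolding kop_def distrib_right by linarith
    also have "\<dots> \<le> 1 * B" using kernel_mass B by (intro mult_right_mono) auto
    finally show "\<bar>kop a r g x\<bar> \<le> B" by simp
  qed
qed

lemma flow_integrable:
  assumes F: "F \<in> bdd_fun (mu \<Otimes>\<^sub>M mu)"
  shows "integrable (mu \<Otimes>\<^sub>M mu) (\<lambda>p. pd (fst p) * a (fst p) (snd p) * F p)"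
proof -
  obtain B where B: "0 \<le> B" "\<And>x. \<bar>F x\<bar> \<le> B" by (rule bdd_funE[OF F]) auto
  note [measurable] = bdd_fun_measurable[OF F] sym_kernelD(1)
  have "integrable (mu \<Otimes>\<^sub>M mu) (\<lambda>p. pd (fst p) * a (fst p) (snd p))"
  proof (rule integrableI_nonneg)
    have "(\<integral>\<^sup>+p. ennreal (pd (fst p) * a (fst p) (snd p)) \<partial>(mu \<Otimes>\<^sub>M mu)) =
        (\<integral>\<^sup>+x. \<integral>\<^sup>+y. ennreal (pd x * a x y) \<partial>mu \<partial>mu)"
      using nn_integral_fst[of "\<lambda>p. ennreal (pd (fst p) * a (fst p) (snd p))" mu] by simp
    also have "\<dots> = (\<integral>\<^sup>+x. ennreal (pd x) * ennreal (LINT y|mu. a x y) \<partial>mu)"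
      by (simp add: ennreal_mult pd_nonneg sym_kernelD nn_integral_cmult kernel_nn_integral)
    also have "\<dots> \<le> (\<integral>\<^sup>+x. ennreal (pd x) * 1 \<partial>mu)"
    proof (intro nn_integral_mono mult_left_mono)
      fix x
      have "(LINT y|mu. a x y) \<le> 1" using kernel_mass[of x] sym_kernelD(4)[of x] by linarith
      then show "ennreal (LINT y|mu. a x y) \<le> 1" by (metis ennreal_1 ennreal_leI)
    qed simp
    finally show "(\<integral>\<^sup>+p. ennreal (pd (fst p) * a (fst p) (snd p)) \<partial>(mu \<Otimes>\<^sub>M mu)) < \<infinity>"
      using pd_mass by (auto intro: le_less_trans)
  qed (auto simp: sym_kernelD pd_nonneg)
  from integrable_mult_right[OF this, of B] show ?thesis
    by (rule Bochner_Integration.integrable_bound)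
      (use B in \<open>auto simp: abs_mult sym_kernelD pd_nonneg mult.commute mult_right_mono\<close>)
qed

text \<open>Swapping the coordinates preserves the product measure, and detailed balance preserves
  the density.\<close>

lemma flow_swap:
  assumes F: "F \<in> bdd_fun (mu \<Otimes>\<^sub>M mu)"
  shows "flow a (\<lambda>p. F (snd p, fst p)) = flow a F"
proof -
  note [measurable] = bdd_fun_measurable[OF F] sym_kernelD(1)
  have "flow a F = (LINT (x, y)|(mu \<Otimes>\<^sub>M mu). pd (fst (y, x)) * a (fst (y, x)) (snd (y, x)) * F (y, x))"
    unfolding flow_def by (rule pair.integral_product_swap[symmetric]) measurable
  also have "\<dots> = flow a (\<lambda>p. F (snd p, fst p))"
    unfolding flow_def
  proof (rule Bochner_Integration.integral_cong, goal_cases)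
    case (2 p)
    show ?case using sym_kernelD(6)[of "snd p" "fst p"] by (simp add: case_prod_beta)
  qed simp
  finally show ?thesis ..
qed

lemma flow_eq_iterated:
  assumes F: "F \<in> bdd_fun (mu \<Otimes>\<^sub>M mu)"
  shows "flow a F = (LINT x|mu. pd x * (LINT y|mu. a x y * F (x, y)))"
  unfolding flow_def pair.integral_fst'[OF flow_integrable[OF F], symmetric]
  by (simp add: mult.assoc)

lemma flow_mono:
  assumes "F \<in> bdd_fun (mu \<Otimes>\<^sub>M mu)" "G \<in> bdd_fun (mu \<Otimes>\<^sub>M mu)" "\<And>p. F p \<le> G p"
  shows "flow a F \<le> flow a G"
  unfolding flow_def using assms
  by (intro integral_mono flow_integrable mult_left_mono mult_nonneg_nonneg) (auto simp: pd_nonneg sym_kernelD)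

lemma flow_add:
  assumes "F \<in> bdd_fun (mu \<Otimes>\<^sub>M mu)" "G \<in> bdd_fun (mu \<Otimes>\<^sub>M mu)"
  shows "flow a (\<lambda>p. F p + G p) = flow a F + flow a G"
  unfolding flow_def using flow_integrable[OF assms(1)] flow_integrable[OF assms(2)]
  by (simp add: distrib_left)

lemma flow_scale: "flow a (\<lambda>p. c * F p) = c * flow a F"
  unfolding flow_def by (subst integral_mult_right_zero[symmetric]) (simp add: mult_ac)

end

lemma bdd_fun_fst: "f \<in> bdd_fun mu \<Longrightarrow> (\<lambda>p. f (fst p)) \<in> bdd_fun (mu \<Otimes>\<^sub>M mu)"
  and bdd_fun_snd: "f \<in> bdd_fun mu \<Longrightarrow> (\<lambda>p. f (snd p)) \<in> bdd_fun (mu \<Otimes>\<^sub>M mu)"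
  by (auto simp: bdd_fun_def)

lemma bdd_fun_square_diff: "g \<in> bdd_fun mu \<Longrightarrow> (\<lambda>p. (g (fst p) - g (snd p))\<^sup>2) \<in> bdd_fun (mu \<Otimes>\<^sub>M mu)"
  unfolding power2_eq_square by (intro bdd_fun_mult bdd_fun_diff bdd_fun_fst bdd_fun_snd)

lemma bdd_fun_square_fst: "g \<in> bdd_fun mu \<Longrightarrow> (\<lambda>p. (g (fst p))\<^sup>2) \<in> bdd_fun (mu \<Otimes>\<^sub>M mu)"
  and bdd_fun_square_snd: "g \<in> bdd_fun mu \<Longrightarrow> (\<lambda>p. (g (snd p))\<^sup>2) \<in> bdd_fun (mu \<Otimes>\<^sub>M mu)"
  unfolding power2_eq_square by (intro bdd_fun_mult bdd_fun_fst bdd_fun_snd; assumption)+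

section \<open>Inner products and Dirichlet forms of kernel operators\<close>

context
  fixes a r assumes ar: "sym_kernel a r"
begin

lemma ip_kop:
  assumes f: "f \<in> bdd_fun mu" and g: "g \<in> bdd_fun mu"
  shows "ip target f (kop a r g) = flow a (\<lambda>p. f (fst p) * g (snd p)) + ip target f (\<lambda>x. r x * g x)"
proof -
  note [measurable] = bdd_fun_measurable[OF f] bdd_fun_measurable[OF g]
    sym_kernelD(1,2)[OF ar]
  have r: "r \<in> bdd_fun mu"
  proof (rule bdd_funI)
    fix x
    have "0 \<le> (LINT y|mu. a x y)" by (intro Bochner_Integration.integral_nonneg sym_kernelD(3)[OF ar])
    then show "\<bar>r x\<bar> \<le> 1" using kernel_mass[OF ar, of x] sym_kernelD(4)[OF ar, of x] by simp
  qed measurable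
  have rg: "(\<lambda>x. r x * g x) \<in> bdd_fun mu" using r g by (rule bdd_fun_mult)
  have ag: "(\<lambda>x. LINT y|mu. a x y * g y) \<in> bdd_fun mu"
    using bdd_fun_diff[OF kop_bdd_fun[OF ar g] rg] by (simp add: kop_def[abs_def])
  have "ip target f (kop a r g) = ip target f (\<lambda>x. LINT y|mu. a x y * g y) + ip target f (\<lambda>x. r x * g x)"
    unfolding kop_def[abs_def] using f ag rg by (intro P.ip_add) auto
  moreover have "ip target f (\<lambda>x. LINT y|mu. a x y * g y) = (LINT x|mu. pd x * (f x * (LINT y|mu. a x y * g y)))"
    unfolding ip_def by (rule integral_target) measurable
  moreover have "(LINT x|mu. pd x * (f x * (LINT y|mu. a x y * g y))) = flow a (\<lambda>p. f (fst p) * g (snd p))"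
  proof -
    have "f x * (LINT y|mu. a x y * g y) = (LINT y|mu. a x y * (f x * g y))" for x
      by (subst integral_mult_right_zero[symmetric]) (simp add: mult_ac)
    then show ?thesis
      using f g by (subst flow_eq_iterated[OF ar]) (auto intro: bdd_fun_fst bdd_fun_snd)
  qed
  ultimately show ?thesis by simp
qed

lemma sym_op_kop: "sym_op target (kop a r)"
proof -
  have "ip target f (kop a r g) = ip target (kop a r f) g"
    if f: "f \<in> bdd_fun mu" and g: "g \<in> bdd_fun mu" for f g
  proof -
    have "flow a (\<lambda>p. f (fst p) * g (snd p)) = flow a (\<lambda>p. g (fst p) * f (snd p))"
      using flow_swap[OF ar bdd_fun_mult[OF bdd_fun_fst[OF g] bdd_fun_snd[OF f]]]
      by (simp add: mult.commute)
    moreover have "ip target f (\<lambda>x. r x * g x) = ip target g (\<lambda>x. r x * f x)"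
      by (simp add: ip_def mult_ac)
    ultimately show ?thesis
      using ip_kop[OF f g] ip_kop[OF g f] ip_commute[of target _ g] by simp
  qed
  then show ?thesis
    using kop_add[OF ar] kop_scale[OF ar] kop_bdd_fun[OF ar] by (simp add: sym_op_def)
qed

text \<open>Used with \<open>m = 1\<close> for whole kernels and with small \<open>m\<close> for the
  part of a kernel that is cut away.\<close>

lemma flow_fst_square_le:
  assumes g: "g \<in> bdd_fun mu" and m: "\<And>x. (LINT y|mu. a x y) \<le> m"
  shows "flow a (\<lambda>p. (g (fst p))\<^sup>2) \<le> m * ip target g g"
proof -
  have g2: "(\<lambda>x. (g x)\<^sup>2) \<in> bdd_fun mu" unfolding power2_eq_square using g by auto
  note [measurable] = bdd_fun_measurable[OF g] sym_kernelD(1)[OF ar]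
  have m0: "0 \<le> m" by (rule order_trans[OF Bochner_Integration.integral_nonneg m]) (rule sym_kernelD(3)[OF ar])
  have "flow a (\<lambda>p. (g (fst p))\<^sup>2) = (LINT x|mu. pd x * ((LINT y|mu. a x y) * (g x)\<^sup>2))"
    by (subst flow_eq_iterated[OF ar bdd_fun_fst[OF g2]]) simp
  also have "\<dots> \<le> (LINT x|mu. m * (pd x * (g x)\<^sup>2))"
  proof (rule integral_mono')
    show "integrable mu (\<lambda>x. m * (pd x * (g x)\<^sup>2))"
      using integrable_target[OF g2] by simp
    fix x
    show "pd x * ((LINT y|mu. a x y) * (g x)\<^sup>2) \<le> m * (pd x * (g x)\<^sup>2)"
      using mult_right_mono[OF m[of x], of "pd x * (g x)\<^sup>2"] pd_nonneg[of x] by (simp add: mult_ac)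
    show "0 \<le> m * (pd x * (g x)\<^sup>2)" using m0 pd_nonneg[of x] by simp
  qed
  also have "\<dots> = m * ip target g g"
    using integral_target[of "\<lambda>x. g x * g x"] by (simp add: ip_def power2_eq_square)
  finally show "flow a (\<lambda>p. (g (fst p))\<^sup>2) \<le> m * ip target g g" .
qed

lemma flow_square_sum:
  assumes g: "g \<in> bdd_fun mu"
  shows "flow a (\<lambda>p. (g (fst p))\<^sup>2 + (g (snd p))\<^sup>2) = 2 * flow a (\<lambda>p. (g (fst p))\<^sup>2)"
proof -
  have "flow a (\<lambda>p. (g (snd p))\<^sup>2) = flow a (\<lambda>p. (g (fst p))\<^sup>2)"
    using flow_swap[OF ar bdd_fun_square_fst[OF g]] by simp
  then show ?thesis
    by (simp add: flow_add[OF ar bdd_fun_square_fst[OF g] bdd_fun_square_snd[OF g]])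
qed

lemma dirichlet_nonneg: "g \<in> bdd_fun mu \<Longrightarrow> 0 \<le> dirichlet a g"
  using flow_mono[OF ar bdd_fun_const[of 0] bdd_fun_square_diff, of g]
  by (simp add: dirichlet_def flow_def)

text \<open>From \<open>(u - v)\<^sup>2 \<le> 2 * (u\<^sup>2 + v\<^sup>2)\<close> and the symmetry
  of the flow. For mass one the constant \<open>2\<close> says that the spectrum does not go below
  \<open>-1\<close>.\<close>

lemma dirichlet_le:
  assumes g: "g \<in> bdd_fun mu"
  shows "dirichlet a g \<le> 2 * ip target g g"
proof -
  have "flow a (\<lambda>p. (g (fst p) - g (snd p))\<^sup>2) \<le> flow a (\<lambda>p. 2 * ((g (fst p))\<^sup>2 + (g (snd p))\<^sup>2))"
  proof (rule flow_mono[OF ar])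
    fix p
    have "0 \<le> (g (fst p) + g (snd p))\<^sup>2" by simp
    then show "(g (fst p) - g (snd p))\<^sup>2 \<le> 2 * ((g (fst p))\<^sup>2 + (g (snd p))\<^sup>2)"
      by (simp add: power2_sum power2_diff)
  qed (rule bdd_fun_square_diff[OF g] bdd_fun_mult[OF bdd_fun_const
      bdd_fun_add[OF bdd_fun_square_fst[OF g] bdd_fun_square_snd[OF g]]])+
  also have "\<dots> = 4 * flow a (\<lambda>p. (g (fst p))\<^sup>2)"
    unfolding flow_scale[OF ar] flow_square_sum[OF g] by simp
  also have "flow a (\<lambda>p. (g (fst p))\<^sup>2) \<le> 1 * ip target g g"
  proof (rule flow_fst_square_le[OF g])
    show "(LINT y|mu. a x y) \<le> 1" for x
      using kernel_mass[OF ar, of x] sym_kernelD(4)[OF ar, of x] by simp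
  qed
  finally show ?thesis by (simp add: dirichlet_def)
qed

text \<open>The two pure squares have equal flow, so after halving one of them remains; together
  with the holding term it gives \<open>ip target g g\<close>, because the mass is one. The mixed
  term is the flow part of \<open>ip_kop\<close>.\<close>

lemma ip_kop_eq_dirichlet:
  assumes g: "g \<in> bdd_fun mu" and r: "\<And>x. (LINT y|mu. a x y) + r x = 1"
  shows "ip target g (kop a r g) = ip target g g - dirichlet a g"
proof -
  note [measurable] = bdd_fun_measurable[OF g] sym_kernelD(1,2)[OF ar]
  let ?A = "\<lambda>p. (g (fst p))\<^sup>2 + (g (snd p))\<^sup>2" and ?B = "\<lambda>p. g (fst p) * g (snd p)"
  have A: "?A \<in> bdd_fun (mu \<Otimes>\<^sub>M mu)" and B: "?B \<in> bdd_fun (mu \<Otimes>\<^sub>M mu)"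
    by (rule bdd_fun_add[OF bdd_fun_square_fst[OF g] bdd_fun_square_snd[OF g]])
      (rule bdd_fun_mult[OF bdd_fun_fst[OF g] bdd_fun_snd[OF g]])
  have "(\<lambda>p. (g (fst p) - g (snd p))\<^sup>2) = (\<lambda>p. ?A p + (- 2) * ?B p)"
    by (auto simp: power2_diff)
  then have "flow a (\<lambda>p. (g (fst p) - g (snd p))\<^sup>2) = flow a (\<lambda>p. ?A p + (- 2) * ?B p)"
    by (rule arg_cong)
  also have "\<dots> = flow a ?A + flow a (\<lambda>p. (- 2) * ?B p)"
    by (rule flow_add[OF ar A bdd_fun_mult[OF bdd_fun_const B]])
  also have "\<dots> = 2 * flow a (\<lambda>p. (g (fst p))\<^sup>2) + (- 2) * flow a ?B"
    unfolding flow_square_sum[OF g] flow_scale[OF ar] ..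
  finally have d: "dirichlet a g = flow a (\<lambda>p. (g (fst p))\<^sup>2) - flow a ?B"
    unfolding dirichlet_def by simp
  have one: "flow a (\<lambda>p. (g (fst p))\<^sup>2) + ip target g (\<lambda>x. r x * g x) = ip target g g"
  proof -
    have g2: "(\<lambda>x. (g x)\<^sup>2) \<in> bdd_fun mu" unfolding power2_eq_square using g by auto
    have rb: "(\<lambda>x. r x * (g x)\<^sup>2) \<in> bdd_fun mu"
    proof -
      have "r \<in> bdd_fun mu"
      proof (rule bdd_funI)
        fix x
        have "0 \<le> (LINT y|mu. a x y)" by (intro Bochner_Integration.integral_nonneg sym_kernelD(3)[OF ar])
        then show "\<bar>r x\<bar> \<le> 1" using r[of x] sym_kernelD(4)[OF ar, of x] by simp
      qed measurable
      then show ?thesis using g2 by (rule bdd_fun_mult)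
    qed
    have ab: "(\<lambda>x. (LINT y|mu. a x y) * (g x)\<^sup>2) \<in> bdd_fun mu"
    proof -
      have "(LINT y|mu. a x y) * (g x)\<^sup>2 = (g x)\<^sup>2 - r x * (g x)\<^sup>2" for x
      proof -
        have "(LINT y|mu. a x y) = 1 - r x" using r[of x] by linarith
        then show ?thesis by (simp add: left_diff_distrib)
      qed
      then show ?thesis using bdd_fun_diff[OF g2 rb] by simp
    qed
    have "flow a (\<lambda>p. (g (fst p))\<^sup>2) = (LINT x|mu. pd x * ((LINT y|mu. a x y) * (g x)\<^sup>2))"
      by (subst flow_eq_iterated[OF ar bdd_fun_fst[OF g2]]) simp
    moreover have "ip target g (\<lambda>x. r x * g x) = (LINT x|mu. pd x * (r x * (g x)\<^sup>2))"
      using integral_target[of "\<lambda>x. g x * (r x * g x)"] by (simp add: ip_def power2_eq_square mult_ac)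
    moreover have "ip target g g = (LINT x|mu. pd x * (g x)\<^sup>2)"
      using integral_target[of "\<lambda>x. g x * g x"] by (simp add: ip_def power2_eq_square)
    moreover have "(LINT x|mu. pd x * ((LINT y|mu. a x y) * (g x)\<^sup>2)) + (LINT x|mu. pd x * (r x * (g x)\<^sup>2))
        = (LINT x|mu. pd x * (g x)\<^sup>2)"
    proof (subst Bochner_Integration.integral_add[symmetric])
      have "pd x * ((LINT y|mu. a x y) * (g x)\<^sup>2) + pd x * (r x * (g x)\<^sup>2) = pd x * (g x)\<^sup>2 * ((LINT y|mu. a x y) + r x)" for x
        by (simp add: algebra_simps)
      then show "(LINT x|mu. pd x * ((LINT y|mu. a x y) * (g x)\<^sup>2) + pd x * (r x * (g x)\<^sup>2)) = (LINT x|mu. pd x * (g x)\<^sup>2)"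
        by (simp add: r)
    qed (use integrable_target[OF ab] integrable_target[OF rb] in auto)
    ultimately show ?thesis by simp
  qed
  show ?thesis using ip_kop[OF g g] d one by simp
qed

end


section \<open>Contraction constants and their comparison\<close>

text \<open>The Dirichlet form lies between \<open>0\<close> and \<open>2 * ip target g g\<close>,
  so the numerical radius is at most \<open>1\<close>.\<close>

lemma kop_contraction:
  assumes ar: "sym_kernel a r" and mass: "\<And>x. (LINT y|mu. a x y) + r x = 1"
    and f: "f \<in> bdd_fun mu"
  shows "P.nrm (kop a r f) \<le> P.nrm f"
proof -
  have "P.nrm (kop a r f) \<le> 1 * P.nrm f"
  proof (rule P.numerical_radius_imp_contraction[OF sym_op_kop[OF ar], of 1 "bdd_fun mu"])
    fix g assume g: "g \<in> bdd_fun mu"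
    show "\<bar>ip target g (kop a r g)\<bar> \<le> 1 * ip target g g"
      using ip_kop_eq_dirichlet[OF ar g mass] dirichlet_nonneg[OF ar g] dirichlet_le[OF ar g]
      by simp
  qed (use f kop_bdd_fun[OF ar] in \<open>auto intro!: bdd_fun_add bdd_fun_mult\<close>)
  then show ?thesis by simp
qed

lemma kop_one:
  assumes "\<And>x. (LINT y|mu. a x y) + r x = 1"
  shows "kop a r (\<lambda>x. 1) = (\<lambda>x. 1)"
  using assms by (simp add: kop_def fun_eq_iff)

text \<open>Pairs at which the flow of \<open>b\<close> is much smaller than the flow of \<open>a\<close> are removed from \<open>a\<close>.
  The removed part is again symmetric, so it contributes at most \<open>2 * \<delta>\<close> to the Dirichlet form.\<close>

lemma dirichlet_comparison:
  assumes ar: "sym_kernel a r" and bs: "sym_kernel b s"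
    and L: "0 \<le> L" and \<delta>: "0 \<le> \<delta>"
    and removed: "\<And>x. (\<integral>\<^sup>+y\<in>{y. L * (pd x * b x y) < pd x * a x y}. ennreal (a x y) \<partial>mu) \<le> ennreal \<delta>"
    and g: "g \<in> bdd_fun mu"
  shows "dirichlet a g \<le> L * dirichlet b g + 2 * \<delta> * ip target g g"
proof -
  note [measurable] = sym_kernelD(1)[OF ar] sym_kernelD(1)[OF bs]
  define c where "c x y = (if L * (pd x * b x y) < pd x * a x y then a x y else 0)" for x y
  have c_meas: "(\<lambda>(x, y). c x y) \<in> borel_measurable (mu \<Otimes>\<^sub>M mu)"
    unfolding c_def by measurable
  have c_int: "(\<integral>\<^sup>+y. ennreal (c x y) \<partial>mu) \<le> ennreal \<delta>" for x
  proof -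
    have "(\<integral>\<^sup>+y. ennreal (c x y) \<partial>mu) =
        (\<integral>\<^sup>+y\<in>{y. L * (pd x * b x y) < pd x * a x y}. ennreal (a x y) \<partial>mu)"
      by (rule nn_integral_cong) (auto simp: c_def indicator_def)
    then show ?thesis using removed[of x] by simp
  qed
  have c: "sym_kernel c (\<lambda>x. 0)"
    unfolding sym_kernel_def
  proof (intro conjI allI)
    fix x y
    show "0 \<le> c x y" by (simp add: c_def sym_kernelD[OF ar])
    have "(\<integral>\<^sup>+y. ennreal (c x y) \<partial>mu) \<le> (\<integral>\<^sup>+y. ennreal (a x y) \<partial>mu)"
      by (rule nn_integral_mono) (auto simp: c_def sym_kernelD[OF ar])
    also have "\<dots> \<le> 1"
      using sym_kernelD(5)[OF ar, of x] by (metis add_increasing2 order.trans le_iff_add)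
    finally show "(\<integral>\<^sup>+y. ennreal (c x y) \<partial>mu) + ennreal 0 \<le> 1" by simp
    \<comment> \<open>The removal condition compares two symmetric flows and is therefore itself
      symmetric in \<open>x\<close> and \<open>y\<close>.\<close>
    show "pd x * c x y = pd y * c y x"
      using sym_kernelD(6)[OF ar, of x y] sym_kernelD(6)[OF bs, of x y] by (simp add: c_def)
  qed (use c_meas in auto)
  have c_mass: "(LINT y|mu. c x y) \<le> \<delta>" for x
    using c_int[of x] \<delta> unfolding kernel_nn_integral[OF c] by simp
  let ?F = "\<lambda>p. (g (fst p) - g (snd p))\<^sup>2" and ?G = "\<lambda>p. (g (fst p))\<^sup>2 + (g (snd p))\<^sup>2"
  have F: "?F \<in> bdd_fun (mu \<Otimes>\<^sub>M mu)" by (rule bdd_fun_square_diff[OF g])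
  have G: "?G \<in> bdd_fun (mu \<Otimes>\<^sub>M mu)"
    by (rule bdd_fun_add[OF bdd_fun_square_fst[OF g] bdd_fun_square_snd[OF g]])
  have "flow a ?F \<le> L * flow b ?F + 2 * flow c ?G"
  proof -
    let ?w = "\<lambda>a p. pd (fst p) * a (fst p) (snd p)"
    have "flow a ?F \<le> (LINT p|(mu \<Otimes>\<^sub>M mu). L * (?w b p * ?F p) + 2 * (?w c p * ?G p))"
      unfolding flow_def
    proof (rule integral_mono)
      fix p :: "'a \<times> 'a"
      have FG: "?F p \<le> 2 * ?G p"
        using zero_le_power2[of "g (fst p) + g (snd p)"] by (simp add: power2_sum power2_diff)
      have wa: "0 \<le> ?w a p" and wb: "0 \<le> ?w b p" and wc: "0 \<le> ?w c p"
        by (auto simp: pd_nonneg sym_kernelD[OF ar] sym_kernelD[OF bs] sym_kernelD[OF c])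
      \<comment> \<open>At a removed pair the flow of \<open>a\<close> is that of \<open>c\<close>,
        and the squared difference is bounded by twice the sum of squares. At any other pair the
        flow of \<open>a\<close> is at most \<open>L\<close> times that of \<open>b\<close>.\<close>
      show "?w a p * ?F p \<le> L * (?w b p * ?F p) + 2 * (?w c p * ?G p)"
      proof (cases "L * ?w b p < ?w a p")
        case True
        then have "?w a p * ?F p \<le> ?w c p * (2 * ?G p)"
          using FG wa unfolding c_def by (simp only: if_True) (rule mult_left_mono)
        moreover have "0 \<le> L * (?w b p * ?F p)"
          by (intro mult_nonneg_nonneg L wb) simp
        moreover have "?w c p * (2 * ?G p) = 2 * (?w c p * ?G p)" by (rule mult.left_commute)
        ultimately show ?thesis by linarith
      next
        case False
        then have "?w a p * ?F p \<le> L * ?w b p * ?F p" by (intro mult_right_mono) auto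
        moreover have "0 \<le> 2 * (?w c p * ?G p)" by (intro mult_nonneg_nonneg wc) auto
        ultimately show ?thesis by (simp add: mult.assoc)
      qed
    qed (use flow_integrable[OF ar F] flow_integrable[OF bs F] flow_integrable[OF c G] in auto)
    also have "\<dots> = L * flow b ?F + 2 * flow c ?G"
      unfolding flow_def using flow_integrable[OF bs F] flow_integrable[OF c G] by simp
    finally show ?thesis .
  qed
  also have "flow c ?G = 2 * flow c (\<lambda>p. (g (fst p))\<^sup>2)"
    by (rule flow_square_sum[OF c g])
  also have "flow c (\<lambda>p. (g (fst p))\<^sup>2) \<le> \<delta> * ip target g g"
    by (rule flow_fst_square_le[OF c g c_mass])
  finally show ?thesis by (simp add: dirichlet_def)
qed

text \<open>With factor \<open>1\<close> and threshold \<open>0\<close> no pair is removed.\<close>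

lemma dirichlet_mono:
  assumes ar: "sym_kernel a r" and bs: "sym_kernel b s"
    and le: "\<And>x y. pd x * b x y \<le> pd x * a x y" and g: "g \<in> bdd_fun mu"
  shows "dirichlet b g \<le> dirichlet a g"
  using dirichlet_comparison[OF bs ar, of 1 0 g] g le by (simp add: not_less[symmetric])

text \<open>Both spectral edges of \<open>kop b s\<close> on centred functions are read off its
  Dirichlet form. Domination by \<open>a\<close> bounds the form above by
  \<open>(1 + \<rho>) * ip target f f\<close>. For the lower bound, a removed mass of
  \<open>(1 - \<rho>) / 4\<close> costs half of the gap of \<open>a\<close>, and the other half
  passes to \<open>b\<close> up to the factor \<open>L\<close>.\<close>

lemma contraction_comparison:
  assumes ar: "sym_kernel a r" and bs: "sym_kernel b s"
    and mass: "\<And>x. (LINT y|mu. a x y) + r x = 1" "\<And>x. (LINT y|mu. b x y) + s x = 1"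
    and le: "\<And>x y. pd x * b x y \<le> pd x * a x y"
    and L: "0 < L" and \<rho>: "0 < \<rho>" "\<rho> < 1"
    and removed: "\<And>x. (\<integral>\<^sup>+y\<in>{y. L * (pd x * b x y) < pd x * a x y}. ennreal (a x y) \<partial>mu)
        \<le> ennreal ((1 - \<rho>) / 4)"
    and contr: "\<And>g. g \<in> bdd_fun mu \<Longrightarrow> (LINT x|target. g x) = 0 \<Longrightarrow>
        P.nrm (kop a r g) \<le> \<rho> * P.nrm g"
    and g: "g \<in> bdd_fun mu" "(LINT x|target. g x) = 0"
  shows "P.nrm (kop b s g) \<le> max \<rho> (1 - (1 - \<rho>) / (2 * L)) * P.nrm g"
proof (rule P.numerical_radius_imp_contraction[OF sym_op_kop[OF bs], of _ "{g \<in> bdd_fun mu. (LINT x|target. g x) = 0}"])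
  let ?t = "max \<rho> (1 - (1 - \<rho>) / (2 * L))"
  show "0 < ?t" using \<rho> by simp
  fix f assume "f \<in> {g \<in> bdd_fun mu. (LINT x|target. g x) = 0}"
  then have f: "f \<in> bdd_fun mu" "(LINT x|target. f x) = 0" by auto
  have nn: "0 \<le> ip target f f" by simp
  have "\<bar>ip target f (kop a r f)\<bar> \<le> P.nrm f * P.nrm (kop a r f)"
    using f kop_bdd_fun[OF ar f(1)] by (intro P.abs_ip_le) auto
  also have "\<dots> \<le> P.nrm f * (\<rho> * P.nrm f)"
    using contr[OF f] by (intro mult_left_mono) auto
  also have "\<dots> = \<rho> * ip target f f"
    by (simp add: P.nrm_power2[symmetric] power2_eq_square)
  finally have E: "\<bar>ip target f f - dirichlet a f\<bar> \<le> \<rho> * ip target f f"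
    unfolding ip_kop_eq_dirichlet[OF ar f(1) mass(1)] .
  have "dirichlet a f \<le> L * dirichlet b f + 2 * ((1 - \<rho>) / 4) * ip target f f"
    using L \<rho> removed f by (intro dirichlet_comparison[OF ar bs]) auto
  moreover have "(1 - \<rho>) * ip target f f \<le> dirichlet a f"
    using E by (simp add: abs_le_iff algebra_simps)
  moreover have "2 * ((1 - \<rho>) / 4) * ip target f f = (1 - \<rho>) * ip target f f / 2" by simp
  ultimately have "(1 - \<rho>) * ip target f f / 2 \<le> L * dirichlet b f" by linarith
  then have lower: "(1 - \<rho>) / (2 * L) * ip target f f \<le> dirichlet b f"
    using L by (simp add: field_simps)
  have upper: "dirichlet b f \<le> (1 + \<rho>) * ip target f f"
    using dirichlet_mono[OF ar bs le f(1)] E by (simp add: abs_le_iff algebra_simps)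
  have "(1 - (1 - \<rho>) / (2 * L)) * ip target f f \<le> ?t * ip target f f"
    "\<rho> * ip target f f \<le> ?t * ip target f f"
    using nn by (intro mult_right_mono; simp)+
  then show "\<bar>ip target f (kop b s f)\<bar> \<le> ?t * ip target f f"
    unfolding ip_kop_eq_dirichlet[OF bs f(1) mass(2)] abs_le_iff
    using lower upper by (simp add: algebra_simps)
next
  fix f assume "f \<in> {g \<in> bdd_fun mu. (LINT x|target. g x) = 0}"
  then show "kop b s f \<in> {g \<in> bdd_fun mu. (LINT x|target. g x) = 0}"
    using P.sym_op_integral[OF sym_op_kop[OF bs] kop_one[OF mass(2)]] kop_bdd_fun[OF bs] by simp
next
  fix f h c
  assume "f \<in> {g \<in> bdd_fun mu. (LINT x|target. g x) = 0}" "h \<in> {g \<in> bdd_fun mu. (LINT x|target. g x) = 0}"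
  then show "(\<lambda>x. f x + c * h x) \<in> {g \<in> bdd_fun mu. (LINT x|target. g x) = 0}"
    using P.bdd_fun_integrable[of f] P.bdd_fun_integrable[of h]
    by (auto intro!: bdd_fun_add bdd_fun_mult)
qed (use g in auto)

text \<open>Truncating the density at that of the target splits off a part with
  values bounded by the \<open>L\<^sup>1\<close> norm of its argument.\<close>

lemma contraction_imp_pointwise_decay:
  assumes ar: "sym_kernel a r" and mass: "\<And>x. (LINT y|mu. a x y) + r x = 1"
    and \<rho>: "0 < \<rho>" "\<rho> < 1"
    and contr: "\<And>g. g \<in> bdd_fun mu \<Longrightarrow> (LINT x|target. g x) = 0 \<Longrightarrow>
        P.nrm (kop a r g) \<le> \<rho> * P.nrm g"
    and moves: "\<not> (AE x in target. AE y in mu. a x y = 0)"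
  obtains s C where "0 < s" "s < 1"
    "AE x in target. \<forall>m f. f \<in> bdd_fun mu \<longrightarrow> (LINT y|target. f y) = 0 \<longrightarrow> (\<forall>y. \<bar>f y\<bar> \<le> 1) \<longrightarrow>
        \<bar>(kop a r ^^ m) f x\<bar> \<le> C x * s ^ m"
proof -
  note [measurable] = sym_kernelD(1,2)[OF ar]
  define b where "b x y = min (a x y) (pd y)" for x y
  define c where "c x y = a x y - b x y" for x y
  have b_meas [measurable]: "(\<lambda>(x, y). b x y) \<in> borel_measurable (mu \<Otimes>\<^sub>M mu)"
    unfolding b_def by measurable
  have c_meas [measurable]: "(\<lambda>(x, y). c x y) \<in> borel_measurable (mu \<Otimes>\<^sub>M mu)"
    unfolding c_def by measurable
  have b0: "0 \<le> b x y" and c0: "0 \<le> c x y" and ba: "b x y \<le> a x y" and ca: "c x y \<le> a x y" for x y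
    by (auto simp: b_def c_def pd_nonneg sym_kernelD[OF ar])
  \<comment> \<open>Multiplied by \<open>pd x\<close>, the truncation is a minimum of two symmetric
    expressions, so \<open>b\<close>, and with it \<open>c\<close>, satisfies detailed
    balance.\<close>
  have flow_b: "pd x * b x y = min (pd x * a x y) (pd x * pd y)" for x y
    by (simp add: b_def min_mult_distrib_left pd_nonneg)
  have b: "sym_kernel b (\<lambda>x. 0)"
    unfolding sym_kernel_def
  proof (intro conjI allI)
    fix x y
    have "(\<integral>\<^sup>+y. ennreal (b x y) \<partial>mu) \<le> (\<integral>\<^sup>+y. ennreal (a x y) \<partial>mu)"
      by (intro nn_integral_mono ennreal_leI ba)
    also have "\<dots> \<le> 1"
      using sym_kernelD(5)[OF ar, of x] by (metis add_increasing2 order.trans le_iff_add)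
    finally show "(\<integral>\<^sup>+y. ennreal (b x y) \<partial>mu) + ennreal 0 \<le> 1" by simp
    show "pd x * b x y = pd y * b y x"
      using sym_kernelD(6)[OF ar, of x y] by (simp add: flow_b mult.commute)
  qed (use b0 in auto)
  have c: "sym_kernel c r"
    unfolding sym_kernel_def
  proof (intro conjI allI)
    fix x y
    have "(\<integral>\<^sup>+y. ennreal (c x y) \<partial>mu) + ennreal (r x) \<le> (\<integral>\<^sup>+y. ennreal (a x y) \<partial>mu) + ennreal (r x)"
      by (intro add_right_mono nn_integral_mono ennreal_leI ca)
    also have "\<dots> \<le> 1" by (rule sym_kernelD(5)[OF ar])
    finally show "(\<integral>\<^sup>+y. ennreal (c x y) \<partial>mu) + ennreal (r x) \<le> 1" .
    show "pd x * c x y = pd y * c y x"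
      using sym_kernelD(6)[OF ar, of x y] sym_kernelD(6)[OF b, of x y]
      by (simp add: c_def right_diff_distrib)
  qed (use c0 sym_kernelD[OF ar] in auto)
  have split: "kop a r f = (\<lambda>x. kop c r f x + kop b (\<lambda>x. 0) f x)" if f: "f \<in> bdd_fun mu" for f
    using kernel_integrable_mult[OF c f] kernel_integrable_mult[OF b f]
    by (simp add: kop_def fun_eq_iff Bochner_Integration.integral_add[symmetric] distrib_right[symmetric])
      (simp add: c_def)
  have bound: "\<bar>kop b (\<lambda>x. 0) f x\<bar> \<le> (LINT y|target. \<bar>f y\<bar>)" if f: "f \<in> bdd_fun mu" for f x
  proof -
    have "\<bar>kop b (\<lambda>x. 0) f x\<bar> \<le> (LINT y|mu. \<bar>b x y * f y\<bar>)"
      by (simp add: kop_def integral_abs_bound)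
    also have "\<dots> \<le> (LINT y|mu. pd y * \<bar>f y\<bar>)"
    proof (rule integral_mono)
      fix y
      have "b x y \<le> pd y" by (simp add: b_def)
      then show "\<bar>b x y * f y\<bar> \<le> pd y * \<bar>f y\<bar>"
        by (simp add: abs_mult b0 mult_right_mono)
    qed (use integrable_abs[OF kernel_integrable_mult[OF b f]] integrable_target[OF bdd_fun_abs[OF f]] in auto)
    also have "\<dots> = (LINT y|target. \<bar>f y\<bar>)"
      using bdd_fun_measurable[OF f] by (subst integral_target) auto
    finally show ?thesis .
  qed
  \<comment> \<open>If the truncated part had no mass, the minimum of \<open>a x y\<close> and
    \<open>pd y\<close> would vanish almost everywhere, and the chain would never move.\<close>
  have K1: "0 < (LINT x|target. kop b (\<lambda>x. 0) (\<lambda>x. 1) x)"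
  proof (rule ccontr)
    assume "\<not> ?thesis"
    moreover have nn: "0 \<le> kop b (\<lambda>x. 0) (\<lambda>x. 1) x" for x by (rule kop_pos[OF b]) simp
    then have "0 \<le> (LINT x|target. kop b (\<lambda>x. 0) (\<lambda>x. 1) x)"
      by (intro Bochner_Integration.integral_nonneg)
    ultimately have "(LINT x|target. kop b (\<lambda>x. 0) (\<lambda>x. 1) x) = 0" by simp
    then have "AE x in target. kop b (\<lambda>x. 0) (\<lambda>x. 1) x = 0"
      using nn P.bdd_fun_integrable[of "kop b (\<lambda>x. 0) (\<lambda>x. 1)"] kop_bdd_fun[OF b bdd_fun_const]
      by (subst (asm) integral_nonneg_eq_0_iff_AE) auto
    moreover have "AE x in target. 0 < pd x"
      unfolding target_def by (subst AE_density) (auto simp: pd_nonneg)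
    ultimately have "AE x in target. AE y in mu. a x y = 0"
    proof eventually_elim
      case (elim x)
      then have "(LINT y|mu. b x y) = 0" by (simp add: kop_def)
      then have "AE y in mu. b x y = 0"
        using kernel_integrable[OF b, of x] b0 by (subst (asm) integral_nonneg_eq_0_iff_AE) auto
      then show ?case
      proof eventually_elim
        case (elim y)
        show ?case
        proof (rule ccontr)
          assume "a x y \<noteq> 0"
          \<comment> \<open>Detailed balance excludes \<open>pd y = 0\<close> at such a pair, so the
            vanishing minimum contradicts \<open>a x y \<noteq> 0\<close>.\<close>
          then have "0 < pd x * a x y" using \<open>0 < pd x\<close> sym_kernelD(3)[OF ar, of x y] by simp
          then have "0 < pd y * a y x" using sym_kernelD(6)[OF ar, of x y] by simp
          then have "pd y \<noteq> 0" by auto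
          with elim \<open>a x y \<noteq> 0\<close> show False by (simp add: b_def min_def split: if_splits)
        qed
      qed
    qed
    with moves show False by simp
  qed
  have "ip target f (kop a r f) \<le> \<rho> * ip target f f"
    if f: "f \<in> bdd_fun mu" "(LINT x|target. f x) = 0" for f
  proof -
    have "ip target f (kop a r f) \<le> P.nrm f * P.nrm (kop a r f)"
      using f kop_bdd_fun[OF ar f(1)] P.abs_ip_le[of f "kop a r f"] by simp
    also have "\<dots> \<le> P.nrm f * (\<rho> * P.nrm f)"
      using contr[OF f] by (intro mult_left_mono) auto
    finally show ?thesis by (simp add: P.nrm_power2[symmetric] power2_eq_square mult.left_commute)
  qed
  then obtain t where t: "0 < t" "t < 1" "\<And>f. f \<in> bdd_fun mu \<Longrightarrow> P.nrm (kop c r f) \<le> t * P.nrm f"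
    using P.residual_contraction[OF sym_op_kop[OF ar] sym_op_kop[OF c] sym_op_kop[OF b], of \<rho>]
      split bound K1 kop_pos[OF c] kop_pos[OF b] kop_one[OF mass] \<rho> by (auto simp del: split_paired_All)
  show ?thesis
    using P.residual_contraction_imp_pointwise_decay[OF sym_op_kop[OF ar] sym_op_kop[OF c] sym_op_kop[OF b], of \<rho> t]
      split bound kop_pos[OF c] kop_one[OF mass] contr t \<rho> that by (auto simp del: split_paired_All)
qed

end

section \<open>Transition kernels and total variation\<close>

lemma bdd_fun_cong_sets: "sets M = sets N \<Longrightarrow> bdd_fun M = bdd_fun N"
  using measurable_cong_sets[of M N "borel :: real measure" borel] by (simp add: bdd_fun_def)

lemma tv_dist_upper:
  assumes "prob_space M" "prob_space N" "sets M = sets N" "A \<in> sets M"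
  shows "\<bar>measure M A - measure N A\<bar> \<le> tv_dist M N"
  unfolding tv_dist_def
proof (rule cSUP_upper[OF assms(4)], rule bdd_aboveI2)
  fix B
  show "\<bar>measure M B - measure N B\<bar> \<le> 1"
    using prob_space.prob_le_1[OF assms(1), of B] prob_space.prob_le_1[OF assms(2), of B]
      measure_nonneg[of M B] measure_nonneg[of N B] by linarith
qed

lemma tv_dist_nonneg:
  assumes "prob_space M" "prob_space N" "sets M = sets N"
  shows "0 \<le> tv_dist M N"
  by (rule order_trans[OF abs_ge_zero tv_dist_upper[OF assms sets.top]])

text \<open>Layer-cake approximation: \<open>f\<close> is within \<open>1 / n\<close> of the mean of the \<open>n\<close> indicators of
  \<open>{f \<ge> i / n}\<close>.\<close>

lemma integral_diff_le_tv_dist: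
  fixes f :: "'a \<Rightarrow> real"
  assumes M: "prob_space M" and N: "prob_space N" and eq: "sets M = sets N"
    and f [measurable]: "f \<in> borel_measurable M" and f01: "\<And>x. 0 \<le> f x" "\<And>x. f x \<le> 1"
  shows "\<bar>(LINT x|M. f x) - (LINT x|N. f x)\<bar> \<le> tv_dist M N"
proof -
  have [measurable]: "f \<in> borel_measurable N" using f eq by (simp cong: measurable_cong_sets)
  define A where "A n i = {x\<in>space M. real i \<le> real n * f x}" for n i :: nat
  have A [measurable]: "A n i \<in> sets M" for n i unfolding A_def by measurable
  have A' [measurable]: "A n i \<in> sets N" for n i using A eq by simp
  define F where "F n x = (\<Sum>i\<in>{1..n}. indicator (A n i) x) / real n" for n x
  have F: "F n x \<le> f x" "f x \<le> F n x + 1 / real n" if "0 < n" "x \<in> space M" for n x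
  proof -
    \<comment> \<open>\<open>k\<close> counts the levels \<open>i\<close> from \<open>1\<close> to
      \<open>n\<close> that are reached. Level \<open>0\<close> is left out, so \<open>F n\<close>
      rounds \<open>f\<close> down.\<close>
    define k where "k = nat \<lfloor>real n * f x\<rfloor>"
    have nf: "0 \<le> real n * f x" "real n * f x \<le> real n"
      using f01[of x] mult_left_mono[of "f x" 1 "real n"] by auto
    then have k: "real k \<le> real n * f x" "real n * f x < real k + 1" "k \<le> n"
      unfolding k_def by (auto simp: nat_le_iff floor_le_iff le_nat_floor)
    have "(\<Sum>i\<in>{1..n}. indicator (A n i) x) = real (card {i\<in>{1..n}. real i \<le> real n * f x})"
      using that(2) by (simp add: A_def indicator_def sum.If_cases Int_def)
    also have "{i\<in>{1..n}. real i \<le> real n * f x} = {1..k}"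
      using k nf by (auto simp: k_def le_nat_floor) linarith+
    finally have "F n x = real k / real n" by (simp add: F_def)
    then show "F n x \<le> f x" "f x \<le> F n x + 1 / real n"
      using k \<open>0 < n\<close>
      by (simp_all add: pos_divide_le_eq pos_le_divide_eq add_divide_distrib[symmetric] mult.commute)
  qed
  have est: "\<bar>(LINT x|M. f x) - (LINT x|N. f x)\<bar> \<le> tv_dist M N + 1 / real n" if n: "0 < n" for n
  proof -
    have int: "(LINT x|Q. F n x) = (\<Sum>i\<in>{1..n}. measure Q (A n i)) / real n"
      "integrable Q (F n)" "integrable Q f"
      "(LINT x|Q. F n x) \<le> (LINT x|Q. f x)" "(LINT x|Q. f x) \<le> (LINT x|Q. F n x) + 1 / real n"
      if Q: "prob_space Q" and sQ: "sets Q = sets M" for Q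
    proof -
      interpret Q: prob_space Q by fact
      have [measurable]: "A n i \<in> sets Q" for i using A sQ by simp
      have fQ [measurable]: "f \<in> borel_measurable Q" using f sQ by (simp cong: measurable_cong_sets)
      have sp: "space Q = space M" using sQ by (rule sets_eq_imp_space_eq)
      show 1: "integrable Q (F n)" unfolding F_def by (auto intro!: integrable_real_indicator)
      show 2: "integrable Q f"
        by (rule Q.integrable_const_bound[of _ 1]) (use f01 in auto)
      show "(LINT x|Q. F n x) = (\<Sum>i\<in>{1..n}. measure Q (A n i)) / real n"
        unfolding F_def by (simp add: Bochner_Integration.integral_sum)
      show "(LINT x|Q. F n x) \<le> (LINT x|Q. f x)"
        using 1 2 F(1)[OF n] sp by (intro integral_mono) auto
      have "(LINT x|Q. f x) \<le> (LINT x|Q. F n x + 1 / real n)"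
        using 1 2 F(2)[OF n] sp by (intro integral_mono) auto
      then show "(LINT x|Q. f x) \<le> (LINT x|Q. F n x) + 1 / real n"
        using 1 by (simp add: Q.prob_space)
    qed
    have "\<bar>(LINT x|M. F n x) - (LINT x|N. F n x)\<bar> =
        \<bar>\<Sum>i\<in>{1..n}. measure M (A n i) - measure N (A n i)\<bar> / real n"
      using int(1)[OF M refl] int(1)[OF N eq[symmetric]]
      by (simp add: sum_subtractf diff_divide_distrib[symmetric])
    also have "\<dots> \<le> (\<Sum>i\<in>{1..n}. tv_dist M N) / real n"
      using tv_dist_upper[OF M N eq A]
      by (intro divide_right_mono order_trans[OF sum_abs] sum_mono) auto
    also have "\<dots> = tv_dist M N" using n by simp
    finally show ?thesis
      using int(4,5)[OF M refl] int(4,5)[OF N eq[symmetric]] by linarith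
  qed
  have "(\<lambda>n. tv_dist M N + inverse (real (Suc n))) \<longlonglongrightarrow> tv_dist M N + 0"
    by (intro tendsto_intros LIMSEQ_inverse_real_of_nat)
  moreover have "\<bar>(LINT x|M. f x) - (LINT x|N. f x)\<bar> \<le> tv_dist M N + inverse (real (Suc n))" for n
    using est[of "Suc n"] by (simp add: inverse_eq_divide)
  ultimately have "\<bar>(LINT x|M. f x) - (LINT x|N. f x)\<bar> \<le> tv_dist M N + 0"
    by (intro LIMSEQ_le_const) auto
  then show ?thesis by simp
qed

section \<open>The Metropolis-Hastings kernel as a measure, and its powers\<close>

context target_density
begin

context
  fixes q \<alpha> :: "'a \<Rightarrow> 'a \<Rightarrow> real" and r :: "'a \<Rightarrow> real" and a
  defines "a \<equiv> \<lambda>x y. q x y * \<alpha> x y"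
  assumes ar: "sym_kernel a r" and mass: "\<And>x. (LINT y|mu. a x y) + r x = 1"
begin

lemma sets_mh_kernel [simp, measurable_cong]: "sets (mh_kernel mu q \<alpha> x) = sets mu"
  and space_mh_kernel [simp]: "space (mh_kernel mu q \<alpha> x) = UNIV"
  using sets.sigma_sets_eq[of mu] sets.space_closed[of mu]
  by (simp_all add: mh_kernel_def)

text \<open>\<open>measure_of\<close> keeps the given set function only if it is countably additive;
  here it is the sum of a density measure and a multiple of a Dirac measure. Since the move mass is
  at most one, the truncated subtraction in \<open>ennreal\<close> gives the true holding mass
  \<open>r x\<close>.\<close>

lemma emeasure_mh_kernel:
  assumes A: "A \<in> sets mu"
  shows "emeasure (mh_kernel mu q \<alpha> x) A =
    (\<integral>\<^sup>+y\<in>A. ennreal (a x y) \<partial>mu) + ennreal (r x) * indicator A x"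
proof -
  note [measurable] = kernel_measurable1[OF ar]
  define \<nu> where "\<nu> A = emeasure (density mu (\<lambda>y. ennreal (a x y))) A + ennreal (r x) * emeasure (return mu x) A" for A
  have r: "1 - (\<integral>\<^sup>+y. ennreal (a x y) \<partial>mu) = ennreal (r x)"
  proof -
    have "0 \<le> (LINT y|mu. a x y)" by (intro Bochner_Integration.integral_nonneg sym_kernelD(3)[OF ar])
    then have "ennreal 1 - ennreal (LINT y|mu. a x y) = ennreal (1 - (LINT y|mu. a x y))"
      by (rule ennreal_minus)
    moreover have "1 - (LINT y|mu. a x y) = r x" using mass[of x] by linarith
    ultimately show ?thesis by (simp add: kernel_nn_integral[OF ar])
  qed
  have \<nu>: "\<nu> B = (\<integral>\<^sup>+y\<in>B. ennreal (a x y) \<partial>mu) + (1 - (\<integral>\<^sup>+y. ennreal (a x y) \<partial>mu)) * indicator B x"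
    if "B \<in> sets mu" for B
    unfolding \<nu>_def r using that by (subst emeasure_density) auto
  have "emeasure (mh_kernel mu q \<alpha> x) A =
      (\<integral>\<^sup>+y\<in>A. ennreal (a x y) \<partial>mu) + (1 - (\<integral>\<^sup>+y. ennreal (a x y) \<partial>mu)) * indicator A x"
    unfolding a_def
  proof (rule emeasure_measure_of[OF mh_kernel_def])
    show "sets mu \<subseteq> Pow (space mu)" by (rule sets.space_closed)
    show "A \<in> sets (mh_kernel mu q \<alpha> x)" using A by simp
    show "positive (sets (mh_kernel mu q \<alpha> x)) (\<lambda>A. (\<integral>\<^sup>+y\<in>A. ennreal (q x y * \<alpha> x y) \<partial>mu)
          + (1 - (\<integral>\<^sup>+y. ennreal (q x y * \<alpha> x y) \<partial>mu)) * indicator A x)"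
      by (simp add: positive_def)
    show "countably_additive (sets (mh_kernel mu q \<alpha> x)) (\<lambda>A. (\<integral>\<^sup>+y\<in>A. ennreal (q x y * \<alpha> x y) \<partial>mu)
          + (1 - (\<integral>\<^sup>+y. ennreal (q x y * \<alpha> x y) \<partial>mu)) * indicator A x)"
    proof (rule countably_additiveI, goal_cases)
      case (1 B)
      then have B: "range B \<subseteq> sets mu" "\<Union> (range B) \<in> sets mu" by auto
      let ?D = "density mu (\<lambda>y. ennreal (a x y))"
      have "(\<Sum>i. \<nu> (B i)) = (\<Sum>i. emeasure ?D (B i)) + (\<Sum>i. ennreal (r x) * emeasure (return mu x) (B i))"
        unfolding \<nu>_def by (rule suminf_add[symmetric]) (rule summableI)+
      also have "(\<Sum>i. emeasure ?D (B i)) = emeasure ?D (\<Union> (range B))"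
        using B 1(2) by (intro suminf_emeasure) auto
      also have "(\<Sum>i. ennreal (r x) * emeasure (return mu x) (B i)) = ennreal (r x) * (\<Sum>i. emeasure (return mu x) (B i))"
        by (rule ennreal_suminf_cmult)
      also have "(\<Sum>i. emeasure (return mu x) (B i)) = emeasure (return mu x) (\<Union> (range B))"
        using B 1(2) by (intro suminf_emeasure) auto
      finally have "(\<Sum>i. \<nu> (B i)) = \<nu> (\<Union> (range B))" unfolding \<nu>_def .
      then show ?case using \<nu> B by (simp add: a_def range_subsetD)
    qed
  qed
  then show ?thesis unfolding r by (simp add: a_def)
qed

lemma nn_integral_mh_kernel:
  assumes "u \<in> borel_measurable mu"
  shows "(\<integral>\<^sup>+y. u y \<partial>mh_kernel mu q \<alpha> x) = (\<integral>\<^sup>+y. ennreal (a x y) * u y \<partial>mu) + ennreal (r x) * u x"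
  using assms
proof (induction rule: borel_measurable_induct)
  case (cong f g)
  then have "f = g" by (auto simp: fun_eq_iff)
  then show ?case using cong by simp
next
  case (set A)
  then show ?case by (simp add: emeasure_mh_kernel)
next
  case (mult u c)
  note [measurable] = mult(2) kernel_measurable1[OF ar]
  have "(\<integral>\<^sup>+y. ennreal (a x y) * (c * u y) \<partial>mu) = c * (\<integral>\<^sup>+y. ennreal (a x y) * u y \<partial>mu)"
    by (subst nn_integral_cmult[symmetric]) (auto simp: mult_ac)
  then show ?case using mult by (simp add: nn_integral_cmult distrib_left mult_ac)
next
  case (add u v)
  note [measurable] = add(1,4) kernel_measurable1[OF ar]
  show ?case using add by (simp add: nn_integral_add distrib_left add_ac)
next
  case (seq U)
  note [measurable] = seq(1) kernel_measurable1[OF ar]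
  have inc: "incseq (\<lambda>i. U i y)" for y using \<open>incseq U\<close> by (auto simp: incseq_def le_fun_def)
  have "(\<integral>\<^sup>+y. (SUP i. U i) y \<partial>mh_kernel mu q \<alpha> x) = (SUP i. \<integral>\<^sup>+y. U i y \<partial>mh_kernel mu q \<alpha> x)"
    unfolding SUP_apply using seq by (intro nn_integral_monotone_convergence_SUP) auto
  also have "\<dots> = (SUP i. (\<integral>\<^sup>+y. ennreal (a x y) * U i y \<partial>mu) + ennreal (r x) * U i x)"
    using seq by simp
  also have "\<dots> = (SUP i. \<integral>\<^sup>+y. ennreal (a x y) * U i y \<partial>mu) + (SUP i. ennreal (r x) * U i x)"
    using \<open>incseq U\<close>
    by (intro ennreal_SUP_add) (auto simp: incseq_def le_fun_def intro!: nn_integral_mono mult_left_mono)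
  also have "(SUP i. \<integral>\<^sup>+y. ennreal (a x y) * U i y \<partial>mu) = (\<integral>\<^sup>+y. (SUP i. ennreal (a x y) * U i y) \<partial>mu)"
    using \<open>incseq U\<close>
    by (intro nn_integral_monotone_convergence_SUP[symmetric])
      (auto simp: incseq_def le_fun_def intro!: mult_left_mono)
  finally show ?case by (simp add: SUP_mult_left_ennreal image_comp)
qed

lemma prob_space_mh_kernel: "prob_space (mh_kernel mu q \<alpha> x)"
proof (rule prob_spaceI)
  have "ennreal (LINT y|mu. a x y) + ennreal (r x) = ennreal ((LINT y|mu. a x y) + r x)"
    by (intro ennreal_plus[symmetric] Bochner_Integration.integral_nonneg sym_kernelD[OF ar])
  then show "emeasure (mh_kernel mu q \<alpha> x) (space (mh_kernel mu q \<alpha> x)) = 1"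
    using emeasure_mh_kernel[of UNIV x] sets.top[of mu] kernel_nn_integral[OF ar, of x] mass[of x] by simp
qed

lemma measurable_mh_kernel: "mh_kernel mu q \<alpha> \<in> mu \<rightarrow>\<^sub>M subprob_algebra mu"
proof (rule measurable_subprob_algebra)
  fix A assume A [measurable]: "A \<in> sets mu"
  note [measurable] = sym_kernelD(1,2)[OF ar]
  show "(\<lambda>x. emeasure (mh_kernel mu q \<alpha> x) A) \<in> borel_measurable mu"
    unfolding emeasure_mh_kernel[OF A] by measurable
qed (auto intro: prob_space_imp_subprob_space prob_space_mh_kernel)

text \<open>Nonnegative functions are treated through \<open>nn_integral_mh_kernel\<close>; adding
  the bound \<open>B\<close> reduces the general case to them.\<close>

lemma integral_mh_kernel:
  assumes g: "g \<in> bdd_fun mu"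
  shows "(LINT y|mh_kernel mu q \<alpha> x. g y) = kop a r g x"
proof -
  interpret K: prob_space "mh_kernel mu q \<alpha> x" by (rule prob_space_mh_kernel)
  obtain B where B: "0 \<le> B" "\<And>x. \<bar>g x\<bar> \<le> B" by (rule bdd_funE[OF g]) auto
  have bdd_K: "bdd_fun (mh_kernel mu q \<alpha> x) = bdd_fun mu"
    by (rule bdd_fun_cong_sets) simp
  have nn: "(LINT y|mh_kernel mu q \<alpha> x. u y) = kop a r u x"
    if u: "u \<in> bdd_fun mu" and pos: "\<And>y. 0 \<le> u y" for u
  proof -
    note [measurable] = bdd_fun_measurable[OF u] kernel_measurable1[OF ar]
    have "ennreal (LINT y|mh_kernel mu q \<alpha> x. u y) = (\<integral>\<^sup>+y. ennreal (u y) \<partial>mh_kernel mu q \<alpha> x)"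
      using u pos bdd_K by (intro nn_integral_eq_integral[symmetric]) auto
    also have "\<dots> = (\<integral>\<^sup>+y. ennreal (a x y * u y) \<partial>mu) + ennreal (r x * u x)"
      by (subst nn_integral_mh_kernel) (auto simp: ennreal_mult pos sym_kernelD[OF ar])
    also have "(\<integral>\<^sup>+y. ennreal (a x y * u y) \<partial>mu) = ennreal (LINT y|mu. a x y * u y)"
      using kernel_integrable_mult[OF ar u] pos
      by (intro nn_integral_eq_integral) (auto simp: sym_kernelD[OF ar])
    also have "\<dots> + ennreal (r x * u x) = ennreal (kop a r u x)"
      unfolding kop_def using pos
      by (intro ennreal_plus[symmetric] Bochner_Integration.integral_nonneg mult_nonneg_nonneg sym_kernelD[OF ar]) auto
    finally show ?thesis
      using pos kop_pos[OF ar, of u x] by (subst (asm) ennreal_inj) (auto intro: Bochner_Integration.integral_nonneg)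
  qed
  have gB: "0 \<le> g y + B" for y using B(2)[of y] by linarith
  have cB: "(\<lambda>y. B) \<in> bdd_fun mu" by auto
  have "(LINT y|mh_kernel mu q \<alpha> x. g y + B) = kop a r (\<lambda>y. g y + B) x"
    using g gB by (intro nn) auto
  also have "\<dots> = kop a r g x + kop a r (\<lambda>y. B) x"
    by (simp add: kop_add[OF ar g cB])
  also have "kop a r (\<lambda>y. B) x = (LINT y|mh_kernel mu q \<alpha> x. B)"
    using B by (intro nn[symmetric]) auto
  finally show ?thesis
    using g bdd_K K.bdd_fun_integrable[of g] by simp
qed

lemma kernel_pow_prob_space:
  "prob_space (kernel_pow mu (mh_kernel mu q \<alpha>) m x) \<and> sets (kernel_pow mu (mh_kernel mu q \<alpha>) m x) = sets mu"
proof (induction m)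
  case 0
  then show ?case by (auto intro: prob_space_return)
next
  case (Suc m)
  let ?N = "kernel_pow mu (mh_kernel mu q \<alpha>) m x"
  interpret N: prob_space ?N using Suc by simp
  have K: "mh_kernel mu q \<alpha> \<in> ?N \<rightarrow>\<^sub>M subprob_algebra mu"
    using Suc measurable_mh_kernel by (simp cong: measurable_cong_sets)
  have "prob_space (bind ?N (mh_kernel mu q \<alpha>))"
    by (rule N.prob_space_bind[OF _ K]) (simp add: prob_space_mh_kernel)
  moreover have "sets (bind ?N (mh_kernel mu q \<alpha>)) = sets mu"
    by (rule sets_bind) (auto simp: N.not_empty)
  ultimately show ?case by simp
qed

text \<open>\<open>kernel_pow\<close> appends its newest step at the end of the chain, so that step
  acts on \<open>g\<close> first; hence the induction over arbitrary \<open>g\<close>.\<close>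

lemma integral_kernel_pow:
  assumes "g \<in> bdd_fun mu"
  shows "(LINT y|kernel_pow mu (mh_kernel mu q \<alpha>) m x. g y) = (kop a r ^^ m) g x"
  using assms
proof (induction m arbitrary: g)
  case 0
  then show ?case by (simp add: integral_return bdd_fun_measurable)
next
  case (Suc m)
  let ?N = "kernel_pow mu (mh_kernel mu q \<alpha>) m x"
  have N: "prob_space ?N" "sets ?N = sets mu" using kernel_pow_prob_space by auto
  interpret N: prob_space ?N by fact
  obtain B where B: "\<And>x. \<bar>g x\<bar> \<le> B" by (rule bdd_funE[OF Suc.prems]) auto
  have K: "mh_kernel mu q \<alpha> \<in> ?N \<rightarrow>\<^sub>M subprob_algebra mu"
    using N measurable_mh_kernel by (simp cong: measurable_cong_sets)
  have "(LINT y|bind ?N (mh_kernel mu q \<alpha>). g y) = (LINT z|?N. LINT y|mh_kernel mu q \<alpha> z. g y)"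
  proof (rule integral_bind[OF bdd_fun_measurable[OF Suc.prems] B K N.finite_measure_axioms])
    show "AE z in ?N. emeasure (mh_kernel mu q \<alpha> z) (space (mh_kernel mu q \<alpha> z)) \<le> ennreal 1"
      using prob_space.emeasure_space_1[OF prob_space_mh_kernel] by simp
  qed
  also have "\<dots> = (LINT z|?N. kop a r g z)"
    by (simp add: integral_mh_kernel[OF Suc.prems])
  also have "\<dots> = (kop a r ^^ m) (kop a r g) x"
    by (rule Suc.IH[OF kop_bdd_fun[OF ar Suc.prems]])
  finally show ?case by (simp add: funpow_swap1)
qed

section \<open>Total variation decay and decay on bounded test functions\<close>

text \<open>Total variation controls integrals of functions with values between \<open>0\<close> and
  \<open>1\<close>. A test function bounded by \<open>B\<close> is brought there by
  \<open>(f + B) / (2 * B)\<close>, which accounts for the factor \<open>2\<close> in the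
  constant.\<close>

lemma geom_ergodicD:
  assumes "geom_ergodic mu target (mh_kernel mu q \<alpha>)"
  obtains \<rho> C where "0 < \<rho>" "\<rho> < 1"
    "AE x in target. \<forall>m f B. f \<in> bdd_fun mu \<longrightarrow> (LINT y|target. f y) = 0 \<longrightarrow> (\<forall>y. \<bar>f y\<bar> \<le> B) \<longrightarrow>
        \<bar>(kop a r ^^ m) f x\<bar> \<le> C x * B * \<rho> ^ m"
proof -
  let ?K = "\<lambda>m x. kernel_pow mu (mh_kernel mu q \<alpha>) m x"
  obtain t D where t: "0 \<le> t" "t < 1" and D: "AE x in target. \<forall>m. tv_dist (?K m x) target \<le> D x * t ^ m"
    using assms unfolding geom_ergodic_def by auto
  \<comment> \<open>The rate in \<open>geom_ergodic\<close> may be \<open>0\<close>, but the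
    contraction argument divides by it.\<close>
  define \<rho> where "\<rho> = max t (1 / 2)"
  have \<rho>: "0 < \<rho>" "\<rho> < 1" "t \<le> \<rho>" using t by (auto simp: \<rho>_def)
  have K: "prob_space (?K m x)" "sets (?K m x) = sets target" for m x
    using kernel_pow_prob_space[of m x] by simp_all
  from D have "AE x in target. \<forall>m f B. f \<in> bdd_fun mu \<longrightarrow> (LINT y|target. f y) = 0 \<longrightarrow> (\<forall>y. \<bar>f y\<bar> \<le> B) \<longrightarrow>
        \<bar>(kop a r ^^ m) f x\<bar> \<le> (2 * D x) * B * \<rho> ^ m"
  proof (eventually_elim, intro allI impI)
    fix x m f B
    assume tv: "\<forall>m. tv_dist (?K m x) target \<le> D x * t ^ m"
      and f: "f \<in> bdd_fun mu" "(LINT y|target. f y) = 0" and B: "\<forall>y. \<bar>f y\<bar> \<le> B"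
    note [measurable] = bdd_fun_measurable[OF f(1)]
    \<comment> \<open>The sign is read off at \<open>m = 0\<close>; it lets the rate be raised from
      \<open>t\<close> to \<open>\<rho>\<close>.\<close>
    have D0: "0 \<le> D x" using tv_dist_nonneg[OF K(1) P.prob_space_axioms K(2), of 0 x] tv
      by (metis mult.right_neutral order_trans power_0)
    have B0: "0 \<le> B" using B abs_ge_zero order_trans by blast
    have "\<bar>(kop a r ^^ m) f x\<bar> \<le> 2 * B * tv_dist (?K m x) target"
    proof (cases "B = 0")
      case True
      then have "f = (\<lambda>y. 0)" using B by auto
      then show ?thesis using integral_kernel_pow[OF f(1), of m x] True by simp
    next
      case False
      then have B1: "0 < B" using B0 by simp
      interpret N: prob_space "?K m x" by (rule K)
      define g where "g y = (f y + B) / (2 * B)" for y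
      have g: "0 \<le> g y" "g y \<le> 1" for y
      proof -
        have "- B \<le> f y" "f y \<le> B" using B[rule_format, of y] by linarith+
        then show "0 \<le> g y" "g y \<le> 1" using B1 by (simp_all add: g_def divide_simps)
      qed
      have gm: "g \<in> borel_measurable (?K m x)"
        unfolding g_def using K(2) by (simp cong: measurable_cong_sets)
      have fi: "integrable (?K m x) f"
        using f(1) N.bdd_fun_integrable[of f] bdd_fun_cong_sets[OF K(2)[of m x]] by simp
      have "(LINT y|?K m x. g y) = ((kop a r ^^ m) f x + B) / (2 * B)"
        unfolding g_def using fi integral_kernel_pow[OF f(1), of m x] by (simp add: N.prob_space)
      moreover have "(LINT y|target. g y) = B / (2 * B)"
        unfolding g_def using f P.bdd_fun_integrable[of f] by (simp add: P.prob_space)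
      ultimately have "\<bar>(kop a r ^^ m) f x / (2 * B)\<bar> \<le> tv_dist (?K m x) target"
        using integral_diff_le_tv_dist[OF K(1) P.prob_space_axioms K(2) gm g]
        by (simp add: add_divide_distrib)
      moreover have "\<bar>(kop a r ^^ m) f x / (2 * B)\<bar> = \<bar>(kop a r ^^ m) f x\<bar> / (2 * B)"
        using B1 by simp
      ultimately show ?thesis using B1 by (simp add: pos_divide_le_eq mult.commute)
    qed
    also have "\<dots> \<le> 2 * B * (D x * \<rho> ^ m)"
      using tv[rule_format, of m] mult_left_mono[OF power_mono[OF \<rho>(3) t(1)] D0, of m] B0
      by (intro mult_left_mono) auto
    finally show "\<bar>(kop a r ^^ m) f x\<bar> \<le> (2 * D x) * B * \<rho> ^ m" by (simp add: mult_ac)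
  qed
  with \<rho>(1,2) show ?thesis by (rule that)
qed

text \<open>Centred indicators suffice: the indicator of \<open>A\<close> minus its target mass is
  bounded by \<open>1\<close>, and \<open>kop a r ^^ m\<close> maps it at \<open>x\<close> to the
  difference of the two measures of \<open>A\<close>.\<close>

lemma geom_ergodicI:
  assumes s: "0 < s" "s < 1"
    and decay: "AE x in target. \<forall>m f. f \<in> bdd_fun mu \<longrightarrow> (LINT y|target. f y) = 0 \<longrightarrow> (\<forall>y. \<bar>f y\<bar> \<le> 1) \<longrightarrow>
        \<bar>(kop a r ^^ m) f x\<bar> \<le> C x * s ^ m"
  shows "geom_ergodic mu target (mh_kernel mu q \<alpha>)"
  unfolding geom_ergodic_def
proof (intro exI conjI)
  show "0 \<le> s" "s < 1" using s by auto
  let ?K = "\<lambda>m x. kernel_pow mu (mh_kernel mu q \<alpha>) m x"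
  show "AE x in target. \<forall>m. tv_dist (?K m x) target \<le> C x * s ^ m"
    using decay
  proof (eventually_elim, intro allI)
    fix x m
    assume *: "\<forall>m f. f \<in> bdd_fun mu \<longrightarrow> (LINT y|target. f y) = 0 \<longrightarrow> (\<forall>y. \<bar>f y\<bar> \<le> 1) \<longrightarrow>
        \<bar>(kop a r ^^ m) f x\<bar> \<le> C x * s ^ m"
    interpret N: prob_space "?K m x" using kernel_pow_prob_space by simp
    have sN: "sets (?K m x) = sets mu" using kernel_pow_prob_space by simp
    show "tv_dist (?K m x) target \<le> C x * s ^ m"
      unfolding tv_dist_def
    proof (rule cSUP_least)
      show "sets (?K m x) \<noteq> {}" using sets.empty_sets by blast
      fix A assume A: "A \<in> sets (?K m x)"
      then have A' [measurable]: "A \<in> sets mu" using sN by simp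
      define f where "f y = indicator A y - measure target A" for y
      have f: "f \<in> bdd_fun mu" unfolding f_def using A' by auto
      have "(LINT y|target. f y) = 0"
        unfolding f_def using A' by (simp add: P.prob_space)
      moreover have "\<bar>f y\<bar> \<le> 1" for y
      proof -
        have "0 \<le> measure target A" "measure target A \<le> 1" by simp_all
        moreover have "indicator A y = (0::real) \<or> indicator A y = (1::real)" by (simp add: indicator_def)
        ultimately show ?thesis unfolding f_def by linarith
      qed
      ultimately have "\<bar>(kop a r ^^ m) f x\<bar> \<le> C x * s ^ m" using * f by blast
      moreover have "(LINT y|?K m x. f y) = measure (?K m x) A - measure target A"
        unfolding f_def using A by (simp add: N.prob_space)
      ultimately show "\<bar>measure (?K m x) A - measure target A\<bar> \<le> C x * s ^ m"
        using integral_kernel_pow[OF f, of m x] by simp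
    qed
  qed
qed

text \<open>From such a point all mass is holding mass, so the kernel is the Dirac measure there.
  This serves the degenerate case in which the chain never moves.\<close>

lemma kernel_pow_stationary:
  assumes "AE y in mu. a x y = 0"
  shows "kernel_pow mu (mh_kernel mu q \<alpha>) m x = return mu x"
proof (induction m)
  case (Suc m)
  have "mh_kernel mu q \<alpha> x = return mu x"
  proof (rule measure_eqI)
    fix A assume "A \<in> sets (mh_kernel mu q \<alpha> x)"
    then have A: "A \<in> sets mu" by simp
    have "(\<integral>\<^sup>+y\<in>A. ennreal (a x y) \<partial>mu) = (\<integral>\<^sup>+y. 0 \<partial>mu)"
      using assms by (intro nn_integral_cong_AE) auto
    moreover have "(LINT y|mu. a x y) = 0" using assms by (rule integral_eq_zero_AE)
    then have "r x = 1" using mass[of x] by simp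
    ultimately show "emeasure (mh_kernel mu q \<alpha> x) A = emeasure (return mu x) A"
      using A by (simp add: emeasure_mh_kernel)
  qed simp
  with Suc show ?case by (simp add: bind_return[OF measurable_mh_kernel])
qed simp

end

end

section \<open>Transfer of geometric ergodicity between two acceptance functions\<close>

text \<open>If \<open>b\<close> never moves, \<open>pos\<close> makes \<open>a\<close> immobile too;
  both chains then coincide from almost every start and the rate carries over. Otherwise the decay
  for \<open>a\<close> gives a contraction, which passes to \<open>b\<close> by
  \<open>contraction_comparison\<close> and is turned back into total variation decay.\<close>

lemma (in target_density) geom_ergodic_comparison:
  fixes q \<alpha> \<beta> :: "'a \<Rightarrow> 'a \<Rightarrow> real"
  defines "a \<equiv> \<lambda>x y. q x y * \<alpha> x y" and "b \<equiv> \<lambda>x y. q x y * \<beta> x y"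
  assumes ar: "sym_kernel a r" and a_mass: "\<And>x. (LINT y|mu. a x y) + r x = 1"
    and bs: "sym_kernel b s" and b_mass: "\<And>x. (LINT y|mu. b x y) + s x = 1"
    and le: "\<And>x y. pd x * b x y \<le> pd x * a x y"
    and pos: "\<And>x y. 0 < pd x * a x y \<Longrightarrow> 0 < pd x * b x y"
    and removed: "\<And>\<delta>. 0 < \<delta> \<Longrightarrow> \<exists>L>0. \<forall>x.
        (\<integral>\<^sup>+y\<in>{y. L * (pd x * b x y) < pd x * a x y}. ennreal (a x y) \<partial>mu) \<le> ennreal \<delta>"
    and ge: "geom_ergodic mu target (mh_kernel mu q \<alpha>)"
  shows "geom_ergodic mu target (mh_kernel mu q \<beta>)"
proof (cases "AE x in target. AE y in mu. b x y = 0")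
  case True
  have "AE x in target. 0 < pd x"
    unfolding target_def by (subst AE_density) (auto simp: pd_nonneg)
  with True have same: "AE x in target. \<forall>m. kernel_pow mu (mh_kernel mu q \<alpha>) m x = kernel_pow mu (mh_kernel mu q \<beta>) m x"
  proof eventually_elim
    case (elim x)
    have "AE y in mu. a x y = 0"
      using elim(1)
    proof eventually_elim
      case (elim y)
      then have "\<not> 0 < pd x * a x y" using pos[of x y] by auto
      then show ?case using \<open>0 < pd x\<close> sym_kernelD(3)[OF ar, of x y]
        by (simp add: zero_less_mult_iff)
    qed
    then show ?case
      using kernel_pow_stationary[OF ar[unfolded a_def] a_mass[unfolded a_def]]
        kernel_pow_stationary[OF bs[unfolded b_def] b_mass[unfolded b_def]] elim(1)
      by (simp add: a_def b_def)
  qed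
  obtain \<rho> C where \<rho>: "0 \<le> \<rho>" "\<rho> < 1"
    and C: "AE x in target. \<forall>m. tv_dist (kernel_pow mu (mh_kernel mu q \<alpha>) m x) target \<le> C x * \<rho> ^ m"
    using ge unfolding geom_ergodic_def by auto
  from same C have "AE x in target. \<forall>m. tv_dist (kernel_pow mu (mh_kernel mu q \<beta>) m x) target \<le> C x * \<rho> ^ m"
    by eventually_elim simp
  then show ?thesis using \<rho> unfolding geom_ergodic_def by blast
next
  case False
  obtain \<rho> C where \<rho>: "0 < \<rho>" "\<rho> < 1"
    and erg: "AE x in target. \<forall>m f B. f \<in> bdd_fun mu \<longrightarrow> (LINT y|target. f y) = 0 \<longrightarrow> (\<forall>y. \<bar>f y\<bar> \<le> B) \<longrightarrow>
        \<bar>(kop a r ^^ m) f x\<bar> \<le> C x * B * \<rho> ^ m"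
    using geom_ergodicD[OF ar[unfolded a_def] a_mass[unfolded a_def] ge] unfolding a_def by blast
  have contr: "P.nrm (kop a r g) \<le> \<rho> * P.nrm g" if "g \<in> bdd_fun mu" "(LINT x|target. g x) = 0" for g
    by (rule P.ergodic_imp_contraction[OF sym_op_kop[OF ar] kop_one[OF a_mass] _ \<rho>(1), of C])
      (use that erg kop_contraction[OF ar a_mass] in auto)
  obtain L where L: "0 < L"
    "\<And>x. (\<integral>\<^sup>+y\<in>{y. L * (pd x * b x y) < pd x * a x y}. ennreal (a x y) \<partial>mu) \<le> ennreal ((1 - \<rho>) / 4)"
    using removed[of "(1 - \<rho>) / 4"] \<rho> by auto
  define t where "t = max \<rho> (1 - (1 - \<rho>) / (2 * L))"
  have t: "0 < t" "t < 1" using \<rho> L by (auto simp: t_def less_max_iff_disj)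
  have "P.nrm (kop b s g) \<le> t * P.nrm g" if "g \<in> bdd_fun mu" "(LINT x|target. g x) = 0" for g
    unfolding t_def by (rule contraction_comparison[OF ar bs a_mass b_mass le L(1) \<rho> L(2) contr that])
  from contraction_imp_pointwise_decay[OF bs b_mass t this False]
  obtain u D where "0 < u" "u < 1"
    "AE x in target. \<forall>m f. f \<in> bdd_fun mu \<longrightarrow> (LINT y|target. f y) = 0 \<longrightarrow> (\<forall>y. \<bar>f y\<bar> \<le> 1) \<longrightarrow>
        \<bar>(kop b s ^^ m) f x\<bar> \<le> D x * u ^ m" by blast
  then show ?thesis
    using geom_ergodicI[OF bs[unfolded b_def] b_mass[unfolded b_def]] unfolding b_def by blast
qed

lemma (in target_density) sym_kernel_acceptance:
  assumes q: "(\<lambda>(x, y). q x y) \<in> borel_measurable (mu \<Otimes>\<^sub>M mu)" "\<And>x y. 0 \<le> q x y"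
    "\<And>x. (\<integral>\<^sup>+y. ennreal (q x y) \<partial>mu) = 1"
    and \<alpha>: "(\<lambda>(x, y). \<alpha> x y) \<in> borel_measurable (mu \<Otimes>\<^sub>M mu)" "\<And>x y. 0 \<le> \<alpha> x y" "\<And>x y. \<alpha> x y \<le> 1"
    and sym: "\<And>x y. pd x * (q x y * \<alpha> x y) = pd y * (q y x * \<alpha> y x)"
  shows "sym_kernel (\<lambda>x y. q x y * \<alpha> x y) (\<lambda>x. 1 - (LINT y|mu. q x y * \<alpha> x y))"
proof -
  note [measurable] = q(1) \<alpha>(1)
  have m: "(\<integral>\<^sup>+y. ennreal (q x y * \<alpha> x y) \<partial>mu) \<le> 1" for x
  proof -
    have "(\<integral>\<^sup>+y. ennreal (q x y * \<alpha> x y) \<partial>mu) \<le> (\<integral>\<^sup>+y. ennreal (q x y) \<partial>mu)"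
      using mult_left_mono[OF \<alpha>(3) q(2)] by (intro nn_integral_mono ennreal_leI) simp
    then show ?thesis by (simp add: q(3))
  qed
  have eq: "(\<integral>\<^sup>+y. ennreal (q x y * \<alpha> x y) \<partial>mu) = ennreal (LINT y|mu. q x y * \<alpha> x y)" for x
  proof (rule nn_integral_eq_integral)
    show "integrable mu (\<lambda>y. q x y * \<alpha> x y)"
    proof (rule integrableI_nonneg)
      show "(\<integral>\<^sup>+y. ennreal (q x y * \<alpha> x y) \<partial>mu) < \<infinity>" using m[of x] le_less_trans by fastforce
    qed (auto simp: q \<alpha>)
  qed (auto simp: q \<alpha>)
  have le1: "(LINT y|mu. q x y * \<alpha> x y) \<le> 1" for x
    using m[of x] unfolding eq by simp
  have "(\<integral>\<^sup>+y. ennreal (q x y * \<alpha> x y) \<partial>mu) + ennreal (1 - (LINT y|mu. q x y * \<alpha> x y)) \<le> 1" for x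
    unfolding eq using le1[of x]
    by (subst ennreal_plus[symmetric]) (auto intro!: Bochner_Integration.integral_nonneg simp: q \<alpha>)
  then show ?thesis
    unfolding sym_kernel_def using le1 sym by (auto simp: q \<alpha>)
qed

section \<open>The flows of the two acceptance functions\<close>

text \<open>If \<open>c * u = 0\<close>, both sides vanish because \<open>d * v\<close> is
  nonnegative, so the convention for division by zero does no harm.\<close>

lemma alpha_MH_flow:
  fixes c d u v :: real
  assumes "0 \<le> c" "0 \<le> d" "0 \<le> u" "0 \<le> v"
  shows "c * u * min 1 (d * v / (c * u)) = min (c * u) (d * v)"
proof (cases "c * u = 0")
  case True
  then show ?thesis using assms by (auto simp: min_def)
next
  case False
  then have "0 < c * u" using assms by (simp add: less_le)
  then show ?thesis using False by (simp add: min_mult_distrib_left)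
qed

text \<open>As before, \<open>c = 0\<close> makes both sides vanish, since \<open>d\<close> is
  nonnegative.\<close>

lemma alpha_3_flow:
  fixes c d u v :: real
  assumes "0 \<le> c" "0 \<le> d"
  shows "c * u * (min 1 (d / c) * (v / (u + v - u * v))) = min c d * (u * v / (u + v - u * v))"
proof -
  have "c * min 1 (d / c) = min c d"
    using assms by (cases "c = 0") (auto simp: min_mult_distrib_left)
  then show ?thesis by (simp add: mult_ac)
qed

text \<open>The denominator is at least \<open>u\<close> and at least \<open>v\<close>, so the
  fraction is at most \<open>v\<close> and at most \<open>u\<close>.\<close>

lemma alpha_3_flow_le:
  fixes c d u v :: real
  assumes cd: "0 \<le> c" "0 \<le> d" and uv: "0 \<le> u" "u \<le> 1" "0 \<le> v" "v \<le> 1"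
  shows "min c d * (u * v / (u + v - u * v)) \<le> min (c * u) (d * v)"
proof -
  have D: "u \<le> u + v - u * v" "v \<le> u + v - u * v"
    using mult_right_mono[OF uv(2,3)] mult_left_mono[OF uv(4,1)] by simp_all
  define t where "t = u * v / (u + v - u * v)"
  have "t \<le> u" "t \<le> v"
    unfolding t_def using mult_left_mono[OF D(2) uv(1)] mult_right_mono[OF D(1) uv(3)] D uv
    by (auto simp: divide_le_eq mult.commute)
  moreover have "0 \<le> t" unfolding t_def using D uv by auto
  ultimately have "min c d * t \<le> c * u" "min c d * t \<le> d * v"
    using cd by (auto intro!: mult_mono)
  then show ?thesis by (simp add: t_def)
qed

text \<open>The fraction is at least half of \<open>min u v\<close>, since
  \<open>u + v - u * v \<le> 2 * max u v\<close>. Whichever of the two ratios is controlled,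
  \<open>min (c * u) (d * v)\<close> is at most \<open>M\<close> times
  \<open>min c d * min u v\<close>.\<close>

lemma alpha_3_flow_ge:
  fixes c d u v M :: real
  assumes cd: "0 < c" "0 < d" and uv: "0 < u" "u \<le> 1" "0 < v" "v \<le> 1" and M: "1 \<le> M"
    and ratio: "v / u \<in> {1 / M..M} \<or> d / c \<in> {1 / M..M}"
  shows "min (c * u) (d * v) \<le> 2 * M * (min c d * (u * v / (u + v - u * v)))"
proof -
  have D: "u \<le> u + v - u * v" "u + v - u * v \<le> 2 * max u v"
    using mult_right_mono[OF uv(2), of v] mult_pos_pos[OF uv(1,3)] uv
      max.cobounded1[of u v] max.cobounded2[of v u] by linarith+
  have "min u v * (u + v - u * v) \<le> min u v * (2 * max u v)"
    using D uv by (intro mult_left_mono) auto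
  also have "\<dots> = 2 * (u * v)" by (simp add: min_def max_def)
  finally have "min u v * (u + v - u * v) \<le> 2 * (u * v)" .
  then have half: "min u v \<le> 2 * (u * v / (u + v - u * v))"
  proof -
    have "0 < u + v - u * v" using D(1) uv(1) by linarith
    then have "min u v \<le> 2 * (u * v) / (u + v - u * v)"
      using \<open>min u v * (u + v - u * v) \<le> 2 * (u * v)\<close> by (simp only: pos_le_divide_eq)
    then show ?thesis by simp
  qed
  have "v \<le> M * u \<and> u \<le> M * v \<or> d \<le> M * c \<and> c \<le> M * d"
    using ratio cd uv M by (auto simp: field_simps)
  then have "min (c * u) (d * v) \<le> M * (min c d * min u v)"
  proof
    assume "v \<le> M * u \<and> u \<le> M * v"
    then have "c * u \<le> M * (c * v)" "d * v \<le> M * (d * u)"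
      using cd by (simp_all add: mult.left_commute mult_left_mono)
    moreover have "c * u \<le> M * (c * u)" "d * v \<le> M * (d * v)" using cd uv M by simp_all
    ultimately show ?thesis by (auto simp: min_def)
  next
    assume "d \<le> M * c \<and> c \<le> M * d"
    then have "d * v \<le> M * (c * v)" "c * u \<le> M * (d * u)"
      using uv by (simp_all add: mult.assoc[symmetric] mult_right_mono)
    moreover have "c * u \<le> M * (c * u)" "d * v \<le> M * (d * v)" using cd uv M by simp_all
    ultimately show ?thesis by (auto simp: min_def)
  qed
  also have "\<dots> \<le> M * (min c d * (2 * (u * v / (u + v - u * v))))"
    using half cd M by (intro mult_left_mono) auto
  finally show ?thesis by (simp add: mult_ac)
qed

lemma hfun_bounds:
  fixes nu :: "'b::metric_space measure"
  assumes "sets nu = sets borel" "\<And>z. 0 \<le> f \<theta> z" "f \<theta> \<in> borel_measurable nu"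
    and dens: "(\<integral>\<^sup>+z. ennreal (f \<theta> z) \<partial>nu) = 1"
  shows "0 \<le> hfun nu f y eps \<theta>" "hfun nu f y eps \<theta> \<le> 1"
proof -
  note [measurable] = assms(3)
  have int: "integrable nu (f \<theta>)"
    by (rule integrableI_nonneg) (use assms in auto)
  have ball: "ball y eps \<in> sets nu" using assms(1) by simp
  have "ennreal (LINT z|nu. f \<theta> z) = 1"
    using nn_integral_eq_integral[OF int] assms by simp
  then have one: "(LINT z|nu. f \<theta> z) = 1" by (simp add: ennreal_eq_1)
  show "0 \<le> hfun nu f y eps \<theta>"
    unfolding hfun_def set_lebesgue_integral_def
    by (intro Bochner_Integration.integral_nonneg) (simp add: assms(2))
  have "hfun nu f y eps \<theta> \<le> (LINT z|nu. f \<theta> z)"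
    unfolding hfun_def set_lebesgue_integral_def
    using integrable_mult_indicator[OF ball int] int assms(2)
    by (intro integral_mono) (auto simp: indicator_def)
  then show "hfun nu f y eps \<theta> \<le> 1" using one by simp
qed

section \<open>Application to the flows of \<open>alpha_MH\<close> and
  \<open>alpha_3\<close>\<close>

theorem theorem4:
  fixes mu :: "'a::metric_space measure" and nu :: "'b::metric_space measure"
    and y :: 'b and eps :: real and p :: "'a \<Rightarrow> real"
    and f :: "'a \<Rightarrow> 'b \<Rightarrow> real" and q :: "'a \<Rightarrow> 'a \<Rightarrow> real"
  defines "h \<equiv> hfun nu f y eps"
  defines "H \<equiv> (\<integral>\<^sup>+\<theta>. ennreal (p \<theta> * h \<theta>) \<partial>mu)"
  defines "pd \<equiv> (\<lambda>\<theta>. p \<theta> * h \<theta> / enn2real H)"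
  defines "\<pi> \<equiv> density mu (\<lambda>\<theta>. ennreal (pd \<theta>))"
  assumes mu_space: "space mu = UNIV" and mu_sets: "sets mu = sets borel"
    and mu_sf: "sigma_finite_measure mu"
    and nu_space: "space nu = UNIV" and nu_sets: "sets nu = sets borel"
    and nu_sf: "sigma_finite_measure nu"
    and eps_pos: "eps > 0"
    and p_nonneg: "\<And>\<theta>. 0 \<le> p \<theta>" and p_meas: "p \<in> borel_measurable mu"
    and f_nonneg: "\<And>\<theta> z. 0 \<le> f \<theta> z"
    and f_meas: "(\<lambda>(\<theta>, z). f \<theta> z) \<in> borel_measurable (mu \<Otimes>\<^sub>M nu)"
    and f_dens: "\<And>\<theta>. (\<integral>\<^sup>+z. ennreal (f \<theta> z) \<partial>nu) = 1"
    and H_pos: "0 < H" and H_fin: "H < \<infinity>"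
    and q_nonneg: "\<And>\<theta> \<eta>. 0 \<le> q \<theta> \<eta>"
    and q_meas: "(\<lambda>(\<theta>, \<eta>). q \<theta> \<eta>) \<in> borel_measurable (mu \<Otimes>\<^sub>M mu)"
    and q_dens: "\<And>\<theta>. (\<integral>\<^sup>+\<eta>. ennreal (q \<theta> \<eta>) \<partial>mu) = 1"
    and cond2: "condition2 mu p q h pd"
    and MH_ge: "geom_ergodic mu \<pi> (mh_kernel mu q (alpha_MH p q h))"
  shows "geom_ergodic mu \<pi> (mh_kernel mu q (alpha_3 p q h))"
proof -
  have h_bounds: "0 \<le> h \<theta>" "h \<theta> \<le> 1" for \<theta>
  proof -
    have "f \<theta> \<in> borel_measurable nu"
      using measurable_compose_Pair1[OF _ f_meas, of \<theta>] mu_space by simp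
    then show "0 \<le> h \<theta>" "h \<theta> \<le> 1"
      unfolding h_def by (intro hfun_bounds[OF nu_sets f_nonneg _ f_dens]; assumption)+
  qed
  interpret nu: sigma_finite_measure nu by (rule nu_sf)
  have h_meas [measurable]: "h \<in> borel_measurable mu"
  proof -
    have [measurable]: "ball y eps \<in> sets nu" using nu_sets by simp
    note [measurable] = f_meas
    show ?thesis
      unfolding h_def hfun_def[abs_def] set_lebesgue_integral_def by measurable
  qed
  note [measurable] = p_meas q_meas
  define H' where "H' = enn2real H"
  have H': "0 < H'" using H_pos H_fin by (simp add: H'_def enn2real_positive_iff)
  have pd_eq: "pd \<theta> = p \<theta> * h \<theta> / H'" for \<theta> by (simp add: pd_def H'_def)
  interpret mu: sigma_finite_measure mu by (rule mu_sf)
  interpret target_density mu pd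
  proof
    show "space mu = UNIV" by (rule mu_space)
    show "pd \<in> borel_measurable mu" unfolding pd_eq[abs_def] by measurable
    show "0 \<le> pd x" for x using p_nonneg h_bounds H' by (simp add: pd_eq)
    have "(\<integral>\<^sup>+x. ennreal (pd x) \<partial>mu) = (\<integral>\<^sup>+x. ennreal (p x * h x) * ennreal (1 / H') \<partial>mu)"
      using p_nonneg h_bounds H' by (intro nn_integral_cong) (simp add: pd_eq ennreal_mult[symmetric])
    also have "\<dots> = H * ennreal (1 / H')"
      unfolding H_def by (rule nn_integral_multc) measurable
    also have "H = ennreal H'" using H_fin by (simp add: H'_def)
    finally show "(\<integral>\<^sup>+x. ennreal (pd x) \<partial>mu) = 1"
      using H' by (simp add: ennreal_mult[symmetric])
  qed
  have \<pi>: "\<pi> = target" by (simp add: \<pi>_def target_def)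
  define c where "c = cfun p q"
  have c0: "0 \<le> c x y" for x y by (simp add: c_def cfun_def p_nonneg q_nonneg)
  define a where "a = (\<lambda>x y. q x y * alpha_MH p q h x y)"
  define b where "b = (\<lambda>x y. q x y * alpha_3 p q h x y)"
  have pdq: "pd x * q x y = c x y * h x / H'" for x y
    by (simp add: pd_eq c_def cfun_def)
  have flow_a: "pd x * a x y = min (c x y * h x) (c y x * h y) / H'" for x y
  proof -
    have "pd x * a x y = c x y * h x * min 1 (c y x * h y / (c x y * h x)) / H'"
      by (simp add: a_def mult.assoc[symmetric] pdq alpha_MH_def c_def)
    then show ?thesis using alpha_MH_flow[OF c0 c0] h_bounds by simp
  qed
  have flow_b: "pd x * b x y = min (c x y) (c y x) * (h x * h y / (h x + h y - h x * h y)) / H'" for x y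
  proof -
    have "pd x * b x y = c x y * h x * (min 1 (c y x / c x y) * (h y / (h x + h y - h x * h y))) / H'"
      by (simp add: b_def mult.assoc[symmetric] pdq alpha_3_def c_def)
    then show ?thesis by (simp only: alpha_3_flow[OF c0 c0])
  qed
  \<comment> \<open>Where \<open>a\<close> moves, all factors are strictly positive, so the premise
    of Condition 2 holds and its quotients are genuine.\<close>
  have flow_pos: "0 < c x y \<and> 0 < c y x \<and> 0 < h x \<and> 0 < h y" if "0 < pd x * a x y" for x y
  proof -
    have "0 < c x y * h x" "0 < c y x * h y"
      using that H' unfolding flow_a by (auto simp: zero_less_divide_iff)
    then show ?thesis using c0[of x y] c0[of y x] h_bounds(1)[of x] h_bounds(1)[of y]
      by (auto simp: zero_less_mult_iff)
  qed
  have MH01: "0 \<le> alpha_MH p q h x y" "alpha_MH p q h x y \<le> 1" for x y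
    using c0 h_bounds by (auto simp: alpha_MH_def c_def[symmetric])
  have MH_meas: "(\<lambda>(x, y). alpha_MH p q h x y) \<in> borel_measurable (mu \<Otimes>\<^sub>M mu)"
    unfolding alpha_MH_def cfun_def by measurable
  have three01: "0 \<le> alpha_3 p q h x y" "alpha_3 p q h x y \<le> 1" for x y
  proof -
    have D: "h y \<le> h x + h y - h x * h y"
      using mult_left_mono[OF h_bounds(2)[of y] h_bounds(1)[of x]] by simp
    then have frac: "0 \<le> h y / (h x + h y - h x * h y)" "h y / (h x + h y - h x * h y) \<le> 1"
      using h_bounds(1)[of y] by (auto simp: divide_le_eq)
    then show "0 \<le> alpha_3 p q h x y"
      unfolding alpha_3_def c_def[symmetric] using c0 by (intro mult_nonneg_nonneg) auto
    show "alpha_3 p q h x y \<le> 1"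
      unfolding alpha_3_def using frac by (intro mult_le_one) auto
  qed
  have three_meas: "(\<lambda>(x, y). alpha_3 p q h x y) \<in> borel_measurable (mu \<Otimes>\<^sub>M mu)"
    unfolding alpha_3_def cfun_def by measurable
  have ar: "sym_kernel a (\<lambda>x. 1 - (LINT y|mu. a x y))"
    unfolding a_def
    by (rule sym_kernel_acceptance[OF q_meas q_nonneg q_dens MH_meas MH01])
      (use flow_a in \<open>simp add: a_def min.commute\<close>)
  have bs: "sym_kernel b (\<lambda>x. 1 - (LINT y|mu. b x y))"
    unfolding b_def
    by (rule sym_kernel_acceptance[OF q_meas q_nonneg q_dens three_meas three01])
      (use flow_b in \<open>simp add: b_def min.commute add.commute mult.commute\<close>)
  have le: "pd x * b x y \<le> pd x * a x y" for x y
    unfolding flow_a flow_b using H' alpha_3_flow_le[OF c0 c0] h_bounds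
    by (intro divide_right_mono) auto
  have pos: "0 < pd x * b x y" if "0 < pd x * a x y" for x y
  proof -
    note pos = flow_pos[OF that]
    have "h x * h y \<le> h x" using mult_left_mono[OF h_bounds(2)[of y] h_bounds(1)[of x]] by simp
    then have "0 < h x + h y - h x * h y" using pos by linarith
    then show ?thesis unfolding flow_b using pos H' by simp
  qed
  have removed: "\<exists>L>0. \<forall>x. (\<integral>\<^sup>+y\<in>{y. L * (pd x * b x y) < pd x * a x y}. ennreal (a x y) \<partial>mu) \<le> ennreal \<delta>"
    if \<delta>: "0 < \<delta>" for \<delta>
  proof -
    \<comment> \<open>Beyond radius \<open>r\<close> the proposals have mass below
      \<open>\<delta>\<close>. Condition 2 at this radius yields \<open>M\<close>, and
      \<open>2 * M\<close> is the factor from \<open>alpha_3_flow_ge\<close>.\<close>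
    from \<delta> obtain r where r: "0 < r" "\<And>x. qmass mu q x (- ball x r) < ennreal \<delta>"
      using cond2 unfolding condition2_def in_Q_def by blast
    then obtain M where M: "1 \<le> M" and ratio:
      "\<And>x y. y \<in> ball x r \<Longrightarrow> 0 < min (pd x * q x y) (pd y * q y x) \<Longrightarrow>
        h y / h x \<in> {1 / M..M} \<or> c y x / c x y \<in> {1 / M..M}"
      using cond2 unfolding condition2_def c_def by meson
    have "(\<integral>\<^sup>+y\<in>{y. 2 * M * (pd x * b x y) < pd x * a x y}. ennreal (a x y) \<partial>mu) \<le> ennreal \<delta>" for x
    proof -
      have far: "y \<notin> ball x r" if less: "2 * M * (pd x * b x y) < pd x * a x y" for y
      proof
        assume y: "y \<in> ball x r"
        have "0 \<le> pd x * b x y" by (simp add: pd_nonneg sym_kernelD[OF bs])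
        then have "0 < pd x * a x y"
          using less M by (smt (verit) mult_nonneg_nonneg)
        note pos = flow_pos[OF this]
        then have "0 < min (pd x * q x y) (pd y * q y x)" using H' by (simp add: pdq)
        from ratio[OF y this]
        have "min (c x y * h x) (c y x * h y) \<le>
            2 * M * (min (c x y) (c y x) * (h x * h y / (h x + h y - h x * h y)))"
          using pos h_bounds M by (intro alpha_3_flow_ge) auto
        from divide_right_mono[OF this, of H'] have "pd x * a x y \<le> 2 * M * (pd x * b x y)"
          using H' by (simp add: flow_a flow_b)
        then show False using less by simp
      qed
      \<comment> \<open>Removed pairs lie outside the ball and the acceptance is at most one, so the
        removed mass is bounded by the tail of the proposal.\<close>
      have "(\<integral>\<^sup>+y\<in>{y. 2 * M * (pd x * b x y) < pd x * a x y}. ennreal (a x y) \<partial>mu) \<le> qmass mu q x (- ball x r)"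
        unfolding qmass_def
      proof (rule nn_integral_mono)
        fix y
        have "a x y \<le> q x y"
          unfolding a_def using mult_left_mono[OF MH01(2) q_nonneg] by simp
        then show "ennreal (a x y) * indicator {y. 2 * M * (pd x * b x y) < pd x * a x y} y
            \<le> ennreal (q x y) * indicator (- ball x r) y"
          using far[of y] by (auto simp: indicator_def ennreal_leI)
      qed
      then show ?thesis using r(2)[of x] by simp
    qed
    then show ?thesis using M by (intro exI[of _ "2 * M"]) auto
  qed
  show ?thesis
    unfolding \<pi>
    by (rule geom_ergodic_comparison[OF ar[unfolded a_def] _ bs[unfolded b_def] _ le[unfolded a_def b_def]
          pos[unfolded a_def b_def] removed[unfolded a_def b_def] MH_ge[unfolded \<pi>]]) simp_all
qed

end
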